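(* Suppose that for every $t\in\mathbb N$ the control set is $$U_t=\Big(\bigcap_{1\le k\le m_i}\{u\in\mathbb R^d:g_t^k(u)\ge0\}\Big)\cap\Big(\bigcap_{1\le j\le m_e}\{u\in\mathbb R^d:e_t^j(u)=0\}\Big),$$ where $g_t^k:\mathbb R^d\to\mathbb R$ and $e_t^j:\mathbb R^d\to\mathbb R$. Let $l\in\{1,2,3\}$ and let $(\underline{\hat x},\underline{\hat u})=((\hat x_t)_{t\in\mathbb N},(\hat u_t)_{t\in\mathbb N})$ be a solution of problem $(P^l_i)$ (defined in the context). Consider the following assumptions, where (i)–(viii) are required for all $t\in\mathbb N$. (i) $\phi_t$ is Fréchet differentiable at $(\hat x_t,\hat u_t)$. (ii) For all $\alpha\in\{1,\dots,n\}$, $f_t^\alpha$ is Fréchet differentiable at $(\hat x_t,\hat u_t)$ when $f_t^\alpha(\hat x_t,\hat u_t)=\hat x_{t+1}^\alpha$. (iii) For all $\alpha\in\{1,\dots,n\}$, $f_t^\alpha$ is lower semicontinuous and Gâteaux differentiable at $(\hat x_t,\hat u_t)$ when $f_t^\alpha(\hat x_t,\hat u_t)>\hat x_{t+1}^\alpha$. (iv) For all $k\in\{1,\dots,m_i\}$, $g_t^k$ is Fréchet differentiable at $\hat u_t$ when $g_t^k(\hat u_t)=0$. (v) For all $k\in\{1,\dots,m_i\}$, $g_t^k$ is lower semicontinuous and Gâteaux differentiable at $\hat u_t$ when $g_t^k(\hat u_t)>0$. (vi) For all $j\in\{1,\dots,m_e\}$, $e_t^j$ is continuous on a neighborhood of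 $\hat u_t$ and Fréchet differentiable at $\hat u_t$. (vii) $\mathrm{span}\{De_t^j(\hat u_t):j\in\{1,\dots,m_e\}\}\cap\mathrm{co}\{D_Gg_t^k(\hat u_t):k\in I_t^s\}=\emptyset$, where $I_t^s:=\{k\in\{1,\dots,m_i\}:g_t^k(\hat u_t)=0\}$. (viii) $De_t^1(\hat u_t),\dots,De_t^{m_e}(\hat u_t)$ are linearly independent. (ix) For all $t\in\mathbb N_*$, $D_{G,1}f_t(\hat x_t,\hat u_t)$ is invertible. (x) For all $t\in\mathbb N_*$: $\frac{\partial f_t^\alpha(\hat x_t,\hat u_t)}{\partial x^\beta}\ge0$ for all $\alpha,\beta\in\{1,\dots,n\}$, and $\frac{\partial f_t^\alpha(\hat x_t,\hat u_t)}{\partial x^\alpha}>0$ for all $\alpha\in\{1,\dots,n\}$. Assume either (i)–(ix), or (i)–(viii) and (x). Then there exist $\lambda_0\in\mathbb R$, $(p_t)_{t\in\mathbb N_*}\in(\mathbb R^{n*})^{\mathbb N_*}$, $(\lambda_{j,t})_{t\in\mathbb N}\in\mathbb R^{\mathbb N}$ for $j\in\{1,\dots,m_e\}$, and $(\mu_{k,t})_{t\in\mathbb N}\in\mathbb R^{\mathbb N}$ for $k\in\{1,\dots,m_i\}$ such that: (NN) $(\lambda_0,p_1)\ne(0,0)$. (Si) $\lambda_0\ge0$, $p_t\ge0$ for all $t\in\mathbb N_*$, and $\mu_{k,t}\ge0$ for all $t\in\mathbb N$ and all $k\in\{1,\dots,m_i\}$. (S$\ell$) For all $t\in\mathbb N$: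 $p_{t+1}^\alpha\cdot(f_t^\alpha(\hat x_t,\hat u_t)-\hat x_{t+1}^\alpha)=0$ for all $\alpha\in\{1,\dots,n\}$, and $\mu_{k,t}\cdot g_t^k(\hat u_t)=0$ for all $k\in\{1,\dots,m_i\}$. (AE) For all $t\in\mathbb N_*$, $p_t=p_{t+1}\circ D_{G,1}f_t(\hat x_t,\hat u_t)+\lambda_0D_1\phi_t(\hat x_t,\hat u_t)$. (WM) For all $t\in\mathbb N$, $p_{t+1}\circ D_{G,2}f_t(\hat x_t,\hat u_t)+\lambda_0D_2\phi_t(\hat x_t,\hat u_t)+\sum_{j=1}^{m_e}\lambda_{j,t}De_t^j(\hat u_t)+\sum_{k=1}^{m_i}\mu_{k,t}D_Gg_t^k(\hat u_t)=0$.
   Context: $\mathbb N=\{0,1,2,\dots\}$, $\mathbb N_*=\mathbb N\setminus\{0\}$; $\mathrm{co}$ denotes convex hull and $\mathrm{span}$ linear span. For each $t\in\mathbb N$, $X_t$ is a nonempty open subset of $\mathbb R^n$, $U_t$ is a nonempty subset of $\mathbb R^d$, $f_t:X_t\times U_t\to X_{t+1}$ is a mapping (with coordinates $f_t^\alpha$, $1\le\alpha\le n$), and $\phi_t:X_t\times U_t\to\mathbb R$ is a function. A point $\sigma\in X_0$ is fixed. The order on $\mathbb R^n$ is coordinatewise: $x\le y$ iff $x^\alpha\le y^\alpha$ for all $\alpha$. $\mathbb R^{n*}$ is the dual of $\mathbb R^n$; $p\in\mathbb R^{n*}$ has coordinates $p^\alpha$ in the canonical dual basis and $p\ge 0$ means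 $p^\alpha\ge0$ for all $\alpha$. $\mathrm{Adm}_i$ is the set of $(\underline x,\underline u)=((x_t)_{t\in\mathbb N},(u_t)_{t\in\mathbb N})\in\prod_{t\in\mathbb N}X_t\times\prod_{t\in\mathbb N}U_t$ such that $x_0=\sigma$ and $x_{t+1}\le f_t(x_t,u_t)$ for all $t\in\mathbb N$. $\mathrm{Dom}_i$ is the set of $(\underline x,\underline u)\in\mathrm{Adm}_i$ such that the series $\sum_{t=0}^{+\infty}\phi_t(x_t,u_t)$ converges in $\mathbb R$, and $J(\underline x,\underline u):=\sum_{t=0}^{+\infty}\phi_t(x_t,u_t)$ on $\mathrm{Dom}_i$. The problems are: $(P^1_i)$: maximize $J(\underline x,\underline u)$ over $(\underline x,\underline u)\in\mathrm{Dom}_i$. $(P^2_i)$: find $(\underline{\hat x},\underline{\hat u})\in\mathrm{Adm}_i$ such that for all $(\underline x,\underline u)\in\mathrm{Adm}_i$, $\limsup_{h\to+\infty}\left(\sum_{t=0}^h\phi_t(\hat x_t,\hat u_t)-\sum_{t=0}^h\phi_t(x_t,u_t)\right)\ge0$. $(P^3_i)$: the same with $\liminf$ in place of $\limsup$. Gâteaux differentiability: for finite-dimensional real normed spaces $E,F$, $A\subset E$, $\Phi:A\to F$ and $a\in A$, $\Phi$ is Gâteaux differentiable at $a$ when for all $v\in E$ the limit $\vec D\Phi(a,v):=\lim_{s\to0}\frac1s(\Phi(a+sv)-\Phi(a))$ exists and $v\mapsto\vec D\Phi(a,v)$ is linear; then $D_G\Phi(a)v:=\vec D\Phi(a,v)$.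 $D\Phi(a)$ denotes the Fréchet differential. If $E=E_1\times E_2$ and $a=(a_1,a_2)$, $D_{G,1}\Phi(a)$ (resp. $D_{G,2}\Phi(a)$) is the Gâteaux differential of $\Phi(\cdot,a_2)$ at $a_1$ (resp. of $\Phi(a_1,\cdot)$ at $a_2$), and $D_1\Phi(a),D_2\Phi(a)$ are the corresponding partial Fréchet differentials. The numbers $\frac{\partial f_t^\alpha(\hat x_t,\hat u_t)}{\partial x^\beta}$ are the entries of the matrix of $D_{G,1}f_t(\hat x_t,\hat u_t)$. *)

theory Defs
  imports "HOL-Analysis.Analysis"
begin

(* The functions f t and phi t of the control problem are total on the product space; only their
   restrictions to X t \<times> U t enter the admissibility conditions and the criterion. Differentiability
   refers to the ambient space: U t has empty interior as soon as there is a nontrivial equality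
   constraint, so derivatives with respect to the control only make sense for functions that are
   also defined around the point. Semicontinuity needs no such extension and is taken relative to
   X t \<times> U t. *)

(* Differentials are elements of the space of (bounded) linear maps, so that linear forms live in a
   real vector space, where span and convex hull are available. *)

definition D_F :: "('a::euclidean_space \<Rightarrow> 'b::real_normed_vector) \<Rightarrow> 'a \<Rightarrow> 'a \<Rightarrow>\<^sub>L 'b" where
  "D_F \<Phi> a = Blinfun (frechet_derivative \<Phi> (at a))"

definition diff_quot :: "('a::real_vector \<Rightarrow> 'b::real_vector) \<Rightarrow> 'a \<Rightarrow> 'a \<Rightarrow> real \<Rightarrow> 'b" where
  "diff_quot \<Phi> a v s = (1 / s) *\<^sub>R (\<Phi> (a + s *\<^sub>R v) - \<Phi> a)"

definition dir_deriv :: "('a::real_vector \<Rightarrow> 'b::real_normed_vector) \<Rightarrow> 'a \<Rightarrow> 'a \<Rightarrow> 'b" where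
  "dir_deriv \<Phi> a v = Lim (at 0) (diff_quot \<Phi> a v)"

definition gateaux_differentiable ::
  "('a::real_vector \<Rightarrow> 'b::real_normed_vector) \<Rightarrow> 'a \<Rightarrow> bool" where
  "gateaux_differentiable \<Phi> a \<longleftrightarrow>
     (\<forall>v. \<exists>l. (diff_quot \<Phi> a v \<longlongrightarrow> l) (at 0)) \<and> linear (dir_deriv \<Phi> a)"

definition D_G :: "('a::euclidean_space \<Rightarrow> 'b::real_normed_vector) \<Rightarrow> 'a \<Rightarrow> 'a \<Rightarrow>\<^sub>L 'b" where
  "D_G \<Phi> a = Blinfun (dir_deriv \<Phi> a)"

definition D_F1 :: "('a::euclidean_space \<times> 'c \<Rightarrow> 'b::real_normed_vector) \<Rightarrow> 'a \<times> 'c \<Rightarrow> 'a \<Rightarrow>\<^sub>L 'b" where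
  "D_F1 \<Phi> a = D_F (\<lambda>x. \<Phi> (x, snd a)) (fst a)"

definition D_F2 :: "('c \<times> 'a::euclidean_space \<Rightarrow> 'b::real_normed_vector) \<Rightarrow> 'c \<times> 'a \<Rightarrow> 'a \<Rightarrow>\<^sub>L 'b" where
  "D_F2 \<Phi> a = D_F (\<lambda>u. \<Phi> (fst a, u)) (snd a)"

definition D_G1 :: "('a::euclidean_space \<times> 'c \<Rightarrow> 'b::real_normed_vector) \<Rightarrow> 'a \<times> 'c \<Rightarrow> 'a \<Rightarrow>\<^sub>L 'b" where
  "D_G1 \<Phi> a = D_G (\<lambda>x. \<Phi> (x, snd a)) (fst a)"

definition D_G2 :: "('c \<times> 'a::euclidean_space \<Rightarrow> 'b::real_normed_vector) \<Rightarrow> 'c \<times> 'a \<Rightarrow> 'a \<Rightarrow>\<^sub>L 'b" where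
  "D_G2 \<Phi> a = D_G (\<lambda>u. \<Phi> (fst a, u)) (snd a)"

definition lsc_at_within :: "('a::topological_space \<Rightarrow> real) \<Rightarrow> 'a \<Rightarrow> 'a set \<Rightarrow> bool" where
  "lsc_at_within \<Phi> a A \<longleftrightarrow> (\<forall>c < \<Phi> a. \<forall>\<^sub>F z in at a within A. c < \<Phi> z)"

definition dual_coord :: "((real^'n) \<Rightarrow>\<^sub>L real) \<Rightarrow> 'n \<Rightarrow> real" where
  "dual_coord p \<alpha> = blinfun_apply p (axis \<alpha> 1)"

definition Adm_i ::
  "(nat \<Rightarrow> (real^'n) set) \<Rightarrow> (nat \<Rightarrow> (real^'d) set) \<Rightarrow> (nat \<Rightarrow> (real^'n) \<times> (real^'d) \<Rightarrow> real^'n) \<Rightarrow>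
   real^'n \<Rightarrow> ((nat \<Rightarrow> real^'n) \<times> (nat \<Rightarrow> real^'d)) set" where
  "Adm_i X U f \<sigma> = {(x, u). (\<forall>t. x t \<in> X t) \<and> (\<forall>t. u t \<in> U t) \<and> x 0 = \<sigma> \<and>
     (\<forall>t. x (Suc t) \<le> f t (x t, u t))}"

definition Dom_i ::
  "(nat \<Rightarrow> (real^'n) set) \<Rightarrow> (nat \<Rightarrow> (real^'d) set) \<Rightarrow> (nat \<Rightarrow> (real^'n) \<times> (real^'d) \<Rightarrow> real^'n) \<Rightarrow>
   real^'n \<Rightarrow> (nat \<Rightarrow> (real^'n) \<times> (real^'d) \<Rightarrow> real) \<Rightarrow>
   ((nat \<Rightarrow> real^'n) \<times> (nat \<Rightarrow> real^'d)) set" where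
  "Dom_i X U f \<sigma> \<phi> = {(x, u) \<in> Adm_i X U f \<sigma>. summable (\<lambda>t. \<phi> t (x t, u t))}"

definition J ::
  "(nat \<Rightarrow> (real^'n) \<times> (real^'d) \<Rightarrow> real) \<Rightarrow> (nat \<Rightarrow> real^'n) \<times> (nat \<Rightarrow> real^'d) \<Rightarrow> real" where
  "J \<phi> = (\<lambda>(x, u). \<Sum>t. \<phi> t (x t, u t))"

definition gap ::
  "(nat \<Rightarrow> (real^'n) \<times> (real^'d) \<Rightarrow> real) \<Rightarrow> (nat \<Rightarrow> real^'n) \<times> (nat \<Rightarrow> real^'d) \<Rightarrow>
   (nat \<Rightarrow> real^'n) \<times> (nat \<Rightarrow> real^'d) \<Rightarrow> nat \<Rightarrow> ereal" where
  "gap \<phi> = (\<lambda>(x', u') (x, u) h.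
     ereal ((\<Sum>t=0..h. \<phi> t (x' t, u' t)) - (\<Sum>t=0..h. \<phi> t (x t, u t))))"

definition solves_P1 where
  "solves_P1 X U f \<sigma> \<phi> z \<longleftrightarrow>
     z \<in> Dom_i X U f \<sigma> \<phi> \<and> (\<forall>w \<in> Dom_i X U f \<sigma> \<phi>. J \<phi> w \<le> J \<phi> z)"

definition solves_P2 where
  "solves_P2 X U f \<sigma> \<phi> z \<longleftrightarrow>
     z \<in> Adm_i X U f \<sigma> \<and> (\<forall>w \<in> Adm_i X U f \<sigma>. limsup (gap \<phi> z w) \<ge> 0)"

definition solves_P3 where
  "solves_P3 X U f \<sigma> \<phi> z \<longleftrightarrow>
     z \<in> Adm_i X U f \<sigma> \<and> (\<forall>w \<in> Adm_i X U f \<sigma>. liminf (gap \<phi> z w) \<ge> 0)"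

definition solves_P where
  "solves_P l X U f \<sigma> \<phi> z \<longleftrightarrow>
     (l = (1::nat) \<and> solves_P1 X U f \<sigma> \<phi> z) \<or>
     (l = 2 \<and> solves_P2 X U f \<sigma> \<phi> z) \<or>
     (l = 3 \<and> solves_P3 X U f \<sigma> \<phi> z)"

end

theory Submission
  imports Defs
begin

text \<open>
  Truncating the problem at a horizon \<open>h\<close>, the reference trajectory stays optimal among the
  trajectories that coincide with it after \<open>h\<close>. A direction that satisfies the linearized equality
  constraints and strictly improves the criterion and all active inequality constraints could be
  bent, by Brouwer's theorem, into an admissible trajectory with a larger criterion; hence there is
  none, and Gordan's alternative yields multipliers for the horizon \<open>h\<close>. Either of the hypotheses
  (ix) and (x) makes a nonnegative adjoint vector \<open>p_(t+1)\<close> with \<open>p_(t+1) \<circ> D_1 f_t = 0\<close> vanish; hence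
  \<open>(\<lambda>_0, p_1)\<close> is nonzero for every horizon and, once normalized, bounds all \<open>p_t\<close> uniformly in \<open>h\<close>.
  Compactness of the product of these bounded sets gives multipliers valid for all horizons.
\<close>

subsection \<open>Theorems of the alternative\<close>

text \<open>Since the dynamics are inequalities, states and controls are independent unknowns: the
  states move along straight lines, strict linearized inequalities absorb the remainders, and only
  the controls are bent, separately at each time. Inactive coordinates of \<open>f\<close> and
  inactive \<open>g\<close> have no usable expansion along a bent curve; lower semicontinuity alone
  keeps them inactive, and their multipliers are zero. Test states vanish after \<open>h\<close>, so
  the last adjoint vector is free and no bound is available from the terminal end. Bounds must
  travel forward from \<open>p_1\<close>, against the direction in which the adjoint equation
  computes \<open>p_t\<close> from \<open>p_(t+1)\<close>. This is why (ix) and (x) enter as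
  injectivity of the transpose of \<open>D_1 f_t\<close> on the nonnegative orthant, and why
  nontriviality concerns \<open>p_1\<close>. Multipliers of the control constraints need no bounds:
  they are rebuilt, one time at a time, after the passage to the limit.\<close>

text \<open>
  Only the image \<open>W\<close> of the family of functionals enters, so that the underlying vector space is
  arbitrary; for horizon \<open>h\<close> its dimension depends on \<open>h\<close>.
\<close>

lemma gordan_alternative:
  fixes W :: "('i \<Rightarrow> real) set"
  assumes "finite I" and "W \<noteq> {}"
    and "\<And>w w' a b. w \<in> W \<Longrightarrow> w' \<in> W \<Longrightarrow> (\<lambda>i. a * w i + b * w' i) \<in> W"
    and "\<not> (\<exists>w\<in>W. \<forall>i\<in>I. w i > 0)"
  shows "\<exists>c. (\<forall>i\<in>I. c i \<ge> 0) \<and> (\<exists>i\<in>I. c i > 0) \<and> (\<forall>w\<in>W. (\<Sum>i\<in>I. c i * w i) = 0)"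
  using assms
proof (induction I arbitrary: W)
  case empty
  then show ?case by auto
next
  case (insert i I)
  note lin = insert.prems(2)
  show ?case
  proof (cases "\<exists>w\<in>W. \<forall>j\<in>I. w j > 0")
    case False
    from insert.IH[OF insert.prems(1,2) False]
    obtain c where c: "\<forall>j\<in>I. c j \<ge> 0" "\<exists>j\<in>I. c j > 0" "\<forall>w\<in>W. (\<Sum>j\<in>I. c j * w j) = 0"
      by blast
    define c' where "c' = c(i := 0)"
    have "(\<Sum>j\<in>I. c' j * w j) = (\<Sum>j\<in>I. c j * w j)" for w
      using insert.hyps by (intro sum.cong) (auto simp: c'_def)
    then show ?thesis
      using c insert.hyps by (intro exI[of _ c']) (auto simp: c'_def, metis)
  next
    case True
    then obtain w0 where w0: "w0 \<in> W" "\<forall>j\<in>I. w0 j > 0" by blast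
    have w0i: "w0 i \<le> 0" using w0 insert.prems(3) by force
    show ?thesis
    proof (cases "\<forall>w\<in>W. w i = 0")
      case True
      define c where "c = (\<lambda>j. if j = i then 1 else 0 :: real)"
      have "(\<Sum>j\<in>I. c j * w j) = 0" for w
        using insert.hyps by (intro sum.neutral) (auto simp: c_def)
      then show ?thesis
        using True insert.hyps by (intro exI[of _ c]) (auto simp: c_def)
    next
      case False
      then obtain u0 where u0: "u0 \<in> W" "u0 i \<noteq> 0" by blast
      \<comment> \<open>\<open>u\<close> has \<open>i\<close>-coordinate 1, so \<open>W\<close> is
        the sum of the line through \<open>u\<close> and the subspace \<open>W0\<close> where
        coordinate \<open>i\<close> vanishes. The induction hypothesis is applied to
        \<open>W0\<close>.\<close>
      define u where "u = (\<lambda>j. (1 / u0 i) * u0 j + 0 * u0 j)"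
      have u: "u \<in> W" "u i = 1" using lin[OF u0(1) u0(1), of "1 / u0 i" 0] u0(2)
        by (auto simp: u_def)
      define W0 where "W0 = {w \<in> W. w i = 0}"
      have "(\<lambda>j. 1 * w0 j + (- w0 i) * u j) \<in> W0"
        using lin[OF w0(1) u(1), of 1 "- w0 i"] u by (simp add: W0_def)
      then have "W0 \<noteq> {}" by blast
      moreover have "(\<lambda>j. a * w j + b * w' j) \<in> W0" if "w \<in> W0" "w' \<in> W0" for w w' a b
        using that lin by (simp add: W0_def)
      \<comment> \<open>A small multiple of \<open>u\<close> would make coordinate \<open>i\<close>
        positive and keep the finitely many others positive, against the premise.\<close>
      moreover have "\<not> (\<exists>w\<in>W0. \<forall>j\<in>I. w j > 0)"
      proof
        assume "\<exists>w\<in>W0. \<forall>j\<in>I. w j > 0"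
        then obtain z where z: "z \<in> W" "z i = 0" "\<forall>j\<in>I. z j > 0" by (auto simp: W0_def)
        have "\<forall>\<^sub>F s in at_right 0. z j + s * u j > 0" if "j \<in> I" for j
        proof -
          have "((\<lambda>s. z j + s * u j) \<longlongrightarrow> z j + 0 * u j) (at_right 0)" by (intro tendsto_intros)
          then show ?thesis using z(3) that by (intro order_tendstoD(1)) auto
        qed
        then have "\<forall>\<^sub>F s in at_right 0. \<forall>j\<in>I. z j + s * u j > 0"
          using insert.hyps by (simp add: eventually_ball_finite)
        moreover have "\<forall>\<^sub>F s in at_right (0::real). s > 0"
          by (simp add: eventually_at_right_less)
        ultimately have "\<forall>\<^sub>F s in at_right 0. s > 0 \<and> (\<forall>j\<in>I. z j + s * u j > 0)"
          by eventually_elim blast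
        then obtain s where s: "s > 0" "\<forall>j\<in>I. z j + s * u j > 0"
          using eventually_happens trivial_limit_at_right_real by blast
        have "(\<lambda>j. 1 * z j + s * u j) \<in> W" using lin z u by blast
        moreover have "\<forall>j\<in>insert i I. 1 * z j + s * u j > 0" using s z u by auto
        ultimately have "\<exists>w\<in>W. \<forall>j\<in>insert i I. w j > 0"
          by (intro bexI[of _ "\<lambda>j. 1 * z j + s * u j"])
        then show False using insert.prems(3) by contradiction
      qed
      ultimately obtain c where c: "\<forall>j\<in>I. c j \<ge> 0" "\<exists>j\<in>I. c j > 0"
        "\<forall>w\<in>W0. (\<Sum>j\<in>I. c j * w j) = 0"
        using insert.IH[of W0] by blast
      \<comment> \<open>On \<open>W\<close> the weighted sum over \<open>I\<close> is a multiple of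
        coordinate \<open>i\<close>, because it vanishes on \<open>W0\<close>; the weight
        \<open>- \<kappa>\<close> at \<open>i\<close> cancels it. Its sign comes from
        \<open>w0\<close>, which is positive on \<open>I\<close> but not at
        \<open>i\<close>.\<close>
      define \<kappa> where "\<kappa> = (\<Sum>j\<in>I. c j * u j)"
      have \<kappa>: "(\<Sum>j\<in>I. c j * w j) = \<kappa> * w i" if "w \<in> W" for w
      proof -
        have "(\<lambda>j. 1 * w j + (- w i) * u j) \<in> W0"
          using lin[OF that u(1), of 1 "- w i"] u by (simp add: W0_def)
        then have "0 = (\<Sum>j\<in>I. c j * (1 * w j + (- w i) * u j))" using c(3) by metis
        also have "\<dots> = (\<Sum>j\<in>I. c j * w j) - \<kappa> * w i"
          by (simp add: \<kappa>_def algebra_simps sum_subtractf sum_distrib_left)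
        finally show ?thesis by simp
      qed
      have "(\<Sum>j\<in>I. c j * w0 j) > 0"
      proof -
        obtain j where "j \<in> I" "c j > 0" using c(2) by blast
        then show ?thesis using c(1) w0(2) insert.hyps
          by (intro sum_pos2[of I j]) (auto intro: less_imp_le)
      qed
      then have "\<kappa> * w0 i > 0" using \<kappa> w0 by simp
      then have "\<kappa> \<le> 0" using w0i by (smt (verit) zero_less_mult_iff)
      define c' where "c' = c(i := - \<kappa>)"
      have "(\<Sum>j\<in>I. c' j * w j) = (\<Sum>j\<in>I. c j * w j)" for w
        using insert.hyps by (intro sum.cong) (auto simp: c'_def)
      then show ?thesis
        using c(1,2) insert.hyps \<kappa> \<open>\<kappa> \<le> 0\<close> by (intro exI[of _ c']) (auto simp: c'_def)
    qed
  qed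
qed

text \<open>Biorthogonal vectors make linear independence explicit: on their span, the
  \<open>E j\<close> become coordinates. They supply the coefficients in the Farkas argument and the
  space of corrections for the equality constraints.\<close>

lemma dual_family:
  fixes E :: "'j \<Rightarrow> 'a::real_normed_vector \<Rightarrow>\<^sub>L real"
  assumes "finite L"
    and "\<And>c. (\<Sum>j\<in>L. c j *\<^sub>R E j) = 0 \<Longrightarrow> \<forall>j\<in>L. c j = (0::real)"
  shows "\<exists>d. \<forall>i\<in>L. \<forall>j\<in>L. E i (d j) = (if i = j then 1 else 0)"
  using assms
proof (induction L)
  case (insert i L)
  have "\<forall>j\<in>L. c j = 0" if "(\<Sum>j\<in>L. c j *\<^sub>R E j) = 0" for c
  proof -
    have "(\<Sum>j\<in>L. (c(i := 0)) j *\<^sub>R E j) = (\<Sum>j\<in>L. c j *\<^sub>R E j)"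
      using insert.hyps by (intro sum.cong) auto
    then have "(\<Sum>j\<in>insert i L. (c(i := 0)) j *\<^sub>R E j) = 0" using that insert.hyps by simp
    then show ?thesis using insert.prems[of "c(i := 0)"] insert.hyps
      by (metis fun_upd_apply insertCI)
  qed
  with insert.IH obtain d where d: "\<forall>k\<in>L. \<forall>j\<in>L. E k (d j) = (if k = j then 1 else 0)"
    by blast
  \<comment> \<open>If \<open>E i\<close> killed the remainder of every \<open>v\<close> modulo the
    old \<open>d j\<close>, it would be a combination of the old functionals, against
    independence.\<close>
  have "\<exists>v. E i (v - (\<Sum>j\<in>L. E j v *\<^sub>R d j)) \<noteq> 0"
  proof (rule ccontr)
    assume "\<not> ?thesis"
    then have 0: "E i (v - (\<Sum>j\<in>L. E j v *\<^sub>R d j)) = 0" for v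
      by (simp only: not_ex not_not)
    have *: "(\<Sum>j\<in>L. E j v * E i (d j)) = E i v" for v
    proof -
      have "E i (v - (\<Sum>j\<in>L. E j v *\<^sub>R d j)) = E i v - (\<Sum>j\<in>L. E j v * E i (d j))"
        by (simp add: blinfun.diff_right blinfun.sum_right blinfun.scaleR_right)
      then show ?thesis using 0[of v] by linarith
    qed
    define c where "c = (\<lambda>j. if j = i then - 1 else E i (d j))"
    have "(\<Sum>j\<in>L. c j *\<^sub>R E j) = (\<Sum>j\<in>L. E i (d j) *\<^sub>R E j)"
      using insert.hyps by (intro sum.cong) (auto simp: c_def)
    then have "(\<Sum>j\<in>insert i L. c j *\<^sub>R E j) = - E i + (\<Sum>j\<in>L. E i (d j) *\<^sub>R E j)"
      using insert.hyps by (simp add: c_def)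
    also have "\<dots> = 0"
      by (rule blinfun_eqI)
        (simp add: blinfun.diff_left blinfun.sum_left blinfun.scaleR_left *
          mult.commute[of "E i _"])
    finally have "c i = 0" using insert.prems by blast
    then show False by (simp add: c_def)
  qed
  then obtain v where v: "E i (v - (\<Sum>j\<in>L. E j v *\<^sub>R d j)) \<noteq> 0" ..
  define w where "w = v - (\<Sum>j\<in>L. E j v *\<^sub>R d j)"
  \<comment> \<open>Dividing by \<open>E i w\<close> normalizes the new vector; subtracting
    multiples of \<open>w\<close>, on which all old functionals vanish, makes \<open>E i\<close>
    vanish on the old vectors.\<close>
  define d' where "d' = (\<lambda>j. if j = i then w /\<^sub>R E i w else d j - (E i (d j) / E i w) *\<^sub>R w)"
  have w0: "E i w \<noteq> 0" using v by (simp add: w_def)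
  have wL: "E k w = 0" if "k \<in> L" for k
  proof -
    have "(\<Sum>j\<in>L. E j v * E k (d j)) = (\<Sum>j\<in>L. if k = j then E j v else 0)"
      using d that by (intro sum.cong) auto
    then show ?thesis using that insert.hyps
      by (simp add: w_def blinfun.diff_right blinfun.sum_right blinfun.scaleR_right)
  qed
  have "\<forall>k\<in>insert i L. \<forall>j\<in>insert i L. E k (d' j) = (if k = j then 1 else 0)"
    using d wL w0 insert.hyps
    by (auto simp: d'_def blinfun.diff_right blinfun.scaleR_right)
  then show ?case by blast
qed auto

text \<open>Removing from \<open>v\<close> its components along the \<open>d j\<close> leaves a
  vector of the common kernel, so \<open>B v\<close> depends only on the numbers
  \<open>E j v\<close>.\<close>

lemma in_span_if_vanishes_on_kernel:
  fixes E :: "'j \<Rightarrow> 'a::real_normed_vector \<Rightarrow>\<^sub>L real"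
  assumes "finite L" and d: "\<forall>i\<in>L. \<forall>j\<in>L. E i (d j) = (if i = j then 1 else 0)"
    and B: "\<And>v. (\<forall>j\<in>L. E j v = 0) \<Longrightarrow> blinfun_apply B v = 0"
  shows "B = (\<Sum>j\<in>L. B (d j) *\<^sub>R E j)"
proof (rule blinfun_eqI)
  fix v
  have "E i (v - (\<Sum>j\<in>L. E j v *\<^sub>R d j)) = 0" if "i \<in> L" for i
  proof -
    have "(\<Sum>j\<in>L. E j v * E i (d j)) = (\<Sum>j\<in>L. if i = j then E j v else 0)"
      using d that by (intro sum.cong) auto
    then show ?thesis using that assms(1)
      by (simp add: blinfun.diff_right blinfun.sum_right blinfun.scaleR_right)
  qed
  then have "B (v - (\<Sum>j\<in>L. E j v *\<^sub>R d j)) = 0" using B by blast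
  then show "B v = (\<Sum>j\<in>L. B (d j) *\<^sub>R E j) v"
    by (simp add: blinfun.diff_right blinfun.sum_right blinfun.scaleR_right
        blinfun.sum_left blinfun.scaleR_left mult.commute)
qed

lemma sum_eq_single:
  assumes "finite A" "k \<in> A" "\<And>t. t \<in> A \<Longrightarrow> t \<noteq> k \<Longrightarrow> g t = 0"
  shows "sum g A = g k"
  using assms by (subst sum.remove[of A k]) auto

text \<open>The dual form of (vii): a nonzero \<open>\<mu>\<close> scaled to total weight 1 gives a
  point of the convex hull, and vanishing on the common kernel places it in the span.\<close>

lemma regular_multipliers_eq_0:
  fixes E :: "'j \<Rightarrow> 'a::real_normed_vector \<Rightarrow>\<^sub>L real" and b :: "'k \<Rightarrow> 'a \<Rightarrow>\<^sub>L real"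
  assumes L: "finite L" and K: "finite K"
    and d: "\<forall>i\<in>L. \<forall>j\<in>L. E i (d j) = (if i = j then 1 else 0)"
    and disj: "span {E j | j. j \<in> L} \<inter> convex hull {b k | k. k \<in> K} = {}"
    and \<mu>: "\<forall>k\<in>K. \<mu> k \<ge> 0" and 0: "\<And>v. (\<forall>j\<in>L. E j v = 0) \<Longrightarrow> (\<Sum>k\<in>K. \<mu> k * b k v) = 0"
  shows "\<forall>k\<in>K. \<mu> k = 0"
proof (rule ccontr)
  assume "\<not> ?thesis"
  then obtain k where k: "k \<in> K" "\<mu> k > 0" using \<mu> by force
  define s where "s = sum \<mu> K"
  have s: "s > 0" unfolding s_def using k \<mu> K by (intro sum_pos2[of K k]) auto
  define x where "x = (\<Sum>k\<in>K. (\<mu> k / s) *\<^sub>R b k)"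
  have "x \<in> convex hull {b k | k. k \<in> K}"
    unfolding x_def
  proof (rule convex_sum[OF K convex_convex_hull])
    show "(\<Sum>k\<in>K. \<mu> k / s) = 1" using s by (simp add: sum_divide_distrib[symmetric] s_def)
  qed (use \<mu> s in \<open>auto intro: hull_inc\<close>)
  moreover have "x = (\<Sum>j\<in>L. x (d j) *\<^sub>R E j)"
  proof (rule in_span_if_vanishes_on_kernel[OF L d])
    fix v assume v: "\<forall>j\<in>L. E j v = 0"
    have "x v = (\<Sum>k\<in>K. \<mu> k * b k v) / s"
      by (simp add: x_def blinfun.sum_left blinfun.scaleR_left sum_divide_distrib)
    then show "x v = 0" using 0[OF v] by simp
  qed
  then have "x \<in> span {E j | j. j \<in> L}"
    by (metis (mono_tags, lifting) mem_Collect_eq span_base span_scale span_sum)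
  ultimately show False using disj by blast
qed

lemma kernel_combination_closed:
  fixes E :: "'j \<Rightarrow> 'a::real_normed_vector \<Rightarrow>\<^sub>L real"
  assumes "\<forall>j\<in>L. E j v = 0" "\<forall>j\<in>L. E j v' = 0"
  shows "\<forall>j\<in>L. E j (a *\<^sub>R v + a' *\<^sub>R v') = 0"
  using assms by (simp add: blinfun.add_right blinfun.scaleR_right)

text \<open>The Mangasarian-Fromovitz form of (vii). Gordan's alternative on the common kernel would
  otherwise produce nonzero weights, which the disjointness forbids.\<close>

lemma regular_direction_exists:
  fixes E :: "'j \<Rightarrow> 'a::real_normed_vector \<Rightarrow>\<^sub>L real" and b :: "'k \<Rightarrow> 'a \<Rightarrow>\<^sub>L real"
  assumes L: "finite L" and K: "finite K"
    and d: "\<forall>i\<in>L. \<forall>j\<in>L. E i (d j) = (if i = j then 1 else 0)"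
    and disj: "span {E j | j. j \<in> L} \<inter> convex hull {b k | k. k \<in> K} = {}"
  shows "\<exists>v. (\<forall>j\<in>L. E j v = 0) \<and> (\<forall>k\<in>K. b k v > 0)"
proof (rule ccontr)
  assume neg: "\<not> ?thesis"
  define W where "W = {\<lambda>k. b k v | v. \<forall>j\<in>L. E j v = 0}"
  have "\<exists>c. (\<forall>k\<in>K. c k \<ge> 0) \<and> (\<exists>k\<in>K. c k > 0) \<and> (\<forall>w\<in>W. (\<Sum>k\<in>K. c k * w k) = 0)"
  proof (rule gordan_alternative[OF K])
    show "W \<noteq> {}" unfolding W_def by (auto intro!: exI[of _ 0])
    show "\<not> (\<exists>w\<in>W. \<forall>i\<in>K. w i > 0)" using neg by (auto simp: W_def)
    fix w w' a a' assume "w \<in> W" "w' \<in> W"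
    then obtain v v' where v: "\<forall>j\<in>L. E j v = 0" "\<forall>j\<in>L. E j v' = 0"
      and w: "w = (\<lambda>k. b k v)" "w' = (\<lambda>k. b k v')"
      by (auto simp: W_def)
    have "(\<lambda>k. a * w k + a' * w' k) = (\<lambda>k. b k (a *\<^sub>R v + a' *\<^sub>R v'))"
      by (simp add: w blinfun.add_right blinfun.scaleR_right)
    then show "(\<lambda>k. a * w k + a' * w' k) \<in> W"
      using kernel_combination_closed[OF v] by (auto simp: W_def)
  qed
  then obtain c where c: "\<forall>k\<in>K. c k \<ge> 0" "\<exists>k\<in>K. c k > 0"
    "\<forall>w\<in>W. (\<Sum>k\<in>K. c k * w k) = 0" by blast
  have "(\<Sum>k\<in>K. c k * b k v) = 0" if "\<forall>j\<in>L. E j v = 0" for v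
    using c(3) that by (auto simp: W_def)
  from regular_multipliers_eq_0[OF L K d disj c(1) this] c(2) show False by auto
qed

text \<open>Gordan's alternative yields a combination in which the weight of \<open>\<psi>\<close>
  might vanish; the disjointness excludes that, and division by this weight normalizes it to
  1.\<close>

lemma farkas_regular:
  fixes E :: "'j \<Rightarrow> 'a::real_normed_vector \<Rightarrow>\<^sub>L real" and b :: "'k \<Rightarrow> 'a \<Rightarrow>\<^sub>L real"
  assumes L: "finite L" and K: "finite K"
    and d: "\<forall>i\<in>L. \<forall>j\<in>L. E i (d j) = (if i = j then 1 else 0)"
    and disj: "span {E j | j. j \<in> L} \<inter> convex hull {b k | k. k \<in> K} = {}"
    and \<psi>: "\<And>v. (\<forall>j\<in>L. E j v = 0) \<Longrightarrow> (\<forall>k\<in>K. b k v > 0) \<Longrightarrow> blinfun_apply \<psi> v \<le> 0"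
  shows "\<exists>lam \<mu>. (\<forall>k\<in>K. \<mu> k \<ge> 0) \<and>
    \<psi> + (\<Sum>j\<in>L. lam j *\<^sub>R E j) + (\<Sum>k\<in>K. \<mu> k *\<^sub>R b k) = 0"
proof -
  \<comment> \<open>\<open>None\<close> indexes the functional \<open>\<psi>\<close>,
    \<open>Some k\<close> the functional \<open>b k\<close>.\<close>
  define w where "w = (\<lambda>v. case_option (blinfun_apply \<psi> v) (\<lambda>k. b k v))"
  define W where "W = {w v | v. \<forall>j\<in>L. E j v = 0}"
  define I where "I = insert None (Some ` K)"
  have sumI: "(\<Sum>i\<in>I. c i * w v i) = c None * \<psi> v + (\<Sum>k\<in>K. c (Some k) * b k v)" for c v
    using K by (simp add: I_def w_def sum.reindex)
  have "\<exists>c. (\<forall>i\<in>I. c i \<ge> 0) \<and> (\<exists>i\<in>I. c i > 0) \<and> (\<forall>w\<in>W. (\<Sum>i\<in>I. c i * w i) = 0)"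
  proof (rule gordan_alternative)
    show "finite I" using K by (simp add: I_def)
    show "W \<noteq> {}" unfolding W_def by (auto intro!: exI[of _ 0])
    show "\<not> (\<exists>w\<in>W. \<forall>i\<in>I. w i > 0)" using \<psi> by (force simp: W_def w_def I_def)
    fix w1 w2 a a' assume "w1 \<in> W" "w2 \<in> W"
    then obtain v v' where v: "\<forall>j\<in>L. E j v = 0" "\<forall>j\<in>L. E j v' = 0"
      and w12: "w1 = w v" "w2 = w v'"
      by (auto simp: W_def)
    have "(\<lambda>i. a * w1 i + a' * w2 i) = w (a *\<^sub>R v + a' *\<^sub>R v')"
      by (rule ext) (simp add: w12 w_def blinfun.add_right blinfun.scaleR_right split: option.split)
    then show "(\<lambda>i. a * w1 i + a' * w2 i) \<in> W"
      using kernel_combination_closed[OF v] by (auto simp: W_def)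
  qed
  then obtain c where c: "\<forall>i\<in>I. c i \<ge> 0" "\<exists>i\<in>I. c i > 0"
    "\<forall>w\<in>W. (\<Sum>i\<in>I. c i * w i) = 0" by blast
  have c0: "c None * \<psi> v + (\<Sum>k\<in>K. c (Some k) * b k v) = 0" if "\<forall>j\<in>L. E j v = 0" for v
    unfolding sumI[symmetric] using c(3) that by (auto simp: W_def)
  have "c None \<noteq> 0"
  proof
    assume "c None = 0"
    then have "\<forall>k\<in>K. c (Some k) = 0"
      using c0 c(1) by (intro regular_multipliers_eq_0[OF L K d disj]) (auto simp: I_def)
    then show False using c(2) \<open>c None = 0\<close> by (auto simp: I_def)
  qed
  then have pos: "c None > 0" using c(1) by (auto simp: I_def less_le)
  define \<mu> where "\<mu> = (\<lambda>k. c (Some k) / c None)"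
  define B where "B = \<psi> + (\<Sum>k\<in>K. \<mu> k *\<^sub>R b k)"
  have "B = (\<Sum>j\<in>L. B (d j) *\<^sub>R E j)"
  proof (rule in_span_if_vanishes_on_kernel[OF L d])
    fix v assume "\<forall>j\<in>L. E j v = 0"
    then have "(c None * \<psi> v + (\<Sum>k\<in>K. c (Some k) * b k v)) / c None = 0" using c0 by simp
    then show "B v = 0" using pos
      by (simp add: B_def \<mu>_def blinfun.add_left blinfun.sum_left blinfun.scaleR_left
          add_divide_distrib sum_divide_distrib)
  qed
  then have "\<psi> + (\<Sum>j\<in>L. (- B (d j)) *\<^sub>R E j) + (\<Sum>k\<in>K. \<mu> k *\<^sub>R b k) = 0"
    by (simp add: B_def sum_negf algebra_simps)
  moreover have "\<forall>k\<in>K. \<mu> k \<ge> 0" using c(1) pos by (auto simp: \<mu>_def I_def)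
  ultimately show ?thesis by (intro exI conjI)
qed

subsection \<open>Multipliers of the linearized problem\<close>

text \<open>Collects what the nonlinear problem has to supply: \<open>r\<close> and \<open>P\<close>
  are the state and control parts of the derivative of the criterion, \<open>A\<close> and
  \<open>B\<close> those of the dynamics, \<open>N t\<close> the kernel of the equality constraints.
  Only coordinates in \<open>act t\<close> compete in \<open>no_improving_direction\<close>;
  \<open>adjoint_injective\<close> is the common consequence of (ix) and (x).\<close>

locale linearized_problem =
  fixes act :: "nat \<Rightarrow> 'n::finite set" and K :: "nat \<Rightarrow> 'k set"
    and N :: "nat \<Rightarrow> 'v::real_vector set"
    and r :: "nat \<Rightarrow> real^'n" and P :: "nat \<Rightarrow> 'v \<Rightarrow> real"
    and A :: "nat \<Rightarrow> real^'n \<Rightarrow> real^'n" and B :: "nat \<Rightarrow> 'v \<Rightarrow> real^'n"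
    and b :: "nat \<Rightarrow> 'k \<Rightarrow> 'v \<Rightarrow> real"
  assumes finite_K: "finite (K t)"
    and N: "subspace (N t)"
    and linear_P: "linear (P t)" and linear_A: "linear (A t)" and linear_B: "linear (B t)"
    and linear_b: "linear (b t k)"
    and no_improving_direction: "\<not> (y 0 = 0 \<and> (\<forall>t>h. y t = 0) \<and> (\<forall>t. v t \<in> N t) \<and>
      (\<Sum>t\<le>h. r t \<bullet> y t + P t (v t)) > 0 \<and>
      (\<forall>t\<le>h. \<forall>\<alpha>\<in>act t. (A t (y t) + B t (v t)) $ \<alpha> > y (Suc t) $ \<alpha>) \<and>
      (\<forall>t\<le>h. \<forall>k\<in>K t. b t k (v t) > 0))"
    and regular_direction: "\<exists>v\<in>N t. \<forall>k\<in>K t. b t k v > 0"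
    and adjoint_injective: "(\<forall>\<alpha>. q $ \<alpha> \<ge> 0) \<Longrightarrow> (\<forall>z. q \<bullet> A (Suc t) z = 0) \<Longrightarrow> q = 0"
begin

text \<open>Gordan's alternative for all times up to \<open>h\<close> at once. The last conclusion
  is stationarity of the Lagrangian, kept as one identity in \<open>(y, v)\<close> from which the
  separate conditions follow by choice of test directions.\<close>

lemma gordan_multipliers:
  obtains c0 :: real and q :: "nat \<Rightarrow> real^'n" and \<mu> :: "nat \<Rightarrow> 'k \<Rightarrow> real"
  where "c0 \<ge> 0" and "\<And>t \<alpha>. q t $ \<alpha> \<ge> 0"
    and "\<And>t k. t \<le> h \<Longrightarrow> k \<in> K t \<Longrightarrow> \<mu> t k \<ge> 0"
    and "\<And>t \<alpha>. \<alpha> \<notin> act t \<or> t > h \<Longrightarrow> q t $ \<alpha> = 0"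
    and "c0 \<noteq> 0 \<or> (\<exists>t\<le>h. q t \<noteq> 0) \<or> (\<exists>t\<le>h. \<exists>k\<in>K t. \<mu> t k \<noteq> 0)"
    and "\<And>y v. y 0 = 0 \<Longrightarrow> (\<And>t. t > h \<Longrightarrow> y t = 0) \<Longrightarrow> (\<And>t. v t \<in> N t) \<Longrightarrow>
      c0 * (\<Sum>t\<le>h. r t \<bullet> y t + P t (v t)) + (\<Sum>t\<le>h. q t \<bullet> (A t (y t) + B t (v t) - y (Suc t)))
        + (\<Sum>t\<le>h. \<Sum>k\<in>K t. \<mu> t k * b t k (v t)) = 0"
proof -
  define adm where "adm = (\<lambda>y v. y 0 = (0::real^'n) \<and> (\<forall>t>h. y t = 0) \<and> (\<forall>t. v t \<in> N t))"
  \<comment> \<open>One coordinate per strict inequality: the criterion, the active coordinates of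
    the dynamics, the active control constraints.\<close>
  define w where "w = (\<lambda>y v. case_sum (\<lambda>_::unit. \<Sum>t\<le>h. r t \<bullet> y t + P t (v t))
     (case_sum (\<lambda>(t, \<alpha>). (A t (y t) + B t (v t) - y (Suc t)) $ \<alpha>) (\<lambda>(t, k). b t k (v t))))"
  define W where "W = {w y v | y v. adm y v}"
  define D where "D = (SIGMA t:{..h}. act t)"
  define G where "G = (SIGMA t:{..h}. K t)"
  define I where "I = {()} <+> (D <+> G)"
  have fin: "finite D" "finite G" using finite_K by (auto simp: D_def G_def)
  have "\<exists>c. (\<forall>i\<in>I. c i \<ge> 0) \<and> (\<exists>i\<in>I. c i > 0) \<and> (\<forall>w\<in>W. (\<Sum>i\<in>I. c i * w i) = 0)"
  proof (rule gordan_alternative)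
    show "finite I" using fin by (simp add: I_def)
    have "adm (\<lambda>_. 0) (\<lambda>_. 0)" using N by (simp add: adm_def subspace_0)
    then show "W \<noteq> {}" unfolding W_def by blast
    show "\<not> (\<exists>w\<in>W. \<forall>i\<in>I. w i > 0)"
    proof
      assume "\<exists>w\<in>W. \<forall>i\<in>I. w i > 0"
      then obtain y v where yv: "adm y v" and pos: "\<And>i. i \<in> I \<Longrightarrow> w y v i > 0"
        by (auto simp: W_def)
      have "w y v (Inl ()) > 0" by (rule pos) (simp add: I_def InlI)
      moreover have "w y v (Inr (Inl (t, \<alpha>))) > 0" if "t \<le> h" "\<alpha> \<in> act t" for t \<alpha>
        using that by (intro pos) (simp add: I_def D_def InlI InrI)
      moreover have "w y v (Inr (Inr (t, k))) > 0" if "t \<le> h" "k \<in> K t" for t k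
        using that by (intro pos) (simp add: I_def G_def InlI InrI)
      ultimately show False
        using no_improving_direction[where y = y and h = h and v = v] yv
          by (simp add: w_def adm_def) blast
    qed
    fix w1 w2 :: "unit + nat \<times> 'n + nat \<times> 'k \<Rightarrow> real" and a a'
    assume "w1 \<in> W" "w2 \<in> W"
    then obtain y v y' v' where adm: "adm y v" "adm y' v'" and w12: "w1 = w y v" "w2 = w y' v'"
      unfolding W_def by blast
    have "(\<lambda>i. a * w1 i + a' * w2 i)
        = w (\<lambda>t. a *\<^sub>R y t + a' *\<^sub>R y' t) (\<lambda>t. a *\<^sub>R v t + a' *\<^sub>R v' t)"
    proof (rule ext)
      fix i :: "unit + nat \<times> 'n + nat \<times> 'k"
      note comb = linear_add[OF linear_P] linear_scale[OF linear_P]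
        linear_add[OF linear_A] linear_scale[OF linear_A]
        linear_add[OF linear_B] linear_scale[OF linear_B]
        linear_add[OF linear_b] linear_scale[OF linear_b]
      consider "i = Inl ()" | t \<alpha> where "i = Inr (Inl (t, \<alpha>))" | t k where "i = Inr (Inr (t, k))"
        by (metis old.sum.exhaust old.unit.exhaust surj_pair)
      then show "a * w1 i + a' * w2 i
          = w (\<lambda>t. a *\<^sub>R y t + a' *\<^sub>R y' t) (\<lambda>t. a *\<^sub>R v t + a' *\<^sub>R v' t) i"
      proof cases
        case 1
        then show ?thesis
          by (simp add: w12 w_def comb inner_add_right sum_distrib_left sum.distrib[symmetric]
              distrib_left add_ac)
      next
        case 2
        then show ?thesis by (simp add: w12 w_def comb algebra_simps)
      next
        case 3
        then show ?thesis by (simp add: w12 w_def comb)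
      qed
    qed
    moreover have "adm (\<lambda>t. a *\<^sub>R y t + a' *\<^sub>R y' t) (\<lambda>t. a *\<^sub>R v t + a' *\<^sub>R v' t)"
      using adm N by (auto simp: adm_def intro!: subspace_add subspace_scale)
    ultimately show "(\<lambda>i. a * w1 i + a' * w2 i) \<in> W" unfolding W_def by blast
  qed
  then obtain c where c: "\<forall>i\<in>I. c i \<ge> 0" "\<exists>i\<in>I. c i > 0"
    "\<forall>w\<in>W. (\<Sum>i\<in>I. c i * w i) = 0" by blast
  define c0 where "c0 = c (Inl ())"
  \<comment> \<open>Extension by zero outside the active coordinates and after \<open>h\<close>
    encodes complementary slackness and the vanishing tail.\<close>
  define q where "q = (\<lambda>t. \<chi> \<alpha>. if t \<le> h \<and> \<alpha> \<in> act t then c (Inr (Inl (t, \<alpha>))) else 0)"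
  define \<mu> where "\<mu> = (\<lambda>t k. c (Inr (Inr (t, k))))"
  have "c0 \<ge> 0" using c(1) by (auto simp: c0_def I_def)
  moreover have "q t $ \<alpha> \<ge> 0" for t \<alpha> using c(1) by (auto simp: q_def I_def D_def InlI InrI)
  moreover have "\<mu> t k \<ge> 0" if "t \<le> h" "k \<in> K t" for t k
    using c(1) that by (auto simp: \<mu>_def I_def G_def InrI)
  moreover have "q t $ \<alpha> = 0" if "\<alpha> \<notin> act t \<or> t > h" for t \<alpha>
    using that by (auto simp: q_def)
  moreover have "c0 \<noteq> 0 \<or> (\<exists>t\<le>h. q t \<noteq> 0) \<or> (\<exists>t\<le>h. \<exists>k\<in>K t. \<mu> t k \<noteq> 0)"
  proof -
    obtain i where i: "i \<in> I" "c i > 0" using c(2) by blast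
    then consider "i = Inl ()" | t \<alpha> where "t \<le> h" "\<alpha> \<in> act t" "i = Inr (Inl (t, \<alpha>))"
      | t k where "t \<le> h" "k \<in> K t" "i = Inr (Inr (t, k))"
      by (auto simp: I_def D_def G_def)
    then show ?thesis
    proof cases
      case (2 t \<alpha>)
      then have "q t $ \<alpha> \<noteq> 0" using i by (simp add: q_def)
      then have "q t \<noteq> 0" by auto
      then show ?thesis using 2 by blast
    qed (use i in \<open>auto simp: c0_def \<mu>_def\<close>)
  qed
  moreover have "c0 * (\<Sum>t\<le>h. r t \<bullet> y t + P t (v t))
      + (\<Sum>t\<le>h. q t \<bullet> (A t (y t) + B t (v t) - y (Suc t)))
      + (\<Sum>t\<le>h. \<Sum>k\<in>K t. \<mu> t k * b t k (v t)) = 0"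
    if y: "y 0 = 0" "\<And>t. t > h \<Longrightarrow> y t = 0" and v: "\<And>t. v t \<in> N t" for y v
  proof -
    have "adm y v" using y v by (simp add: adm_def)
    then have "0 = (\<Sum>i\<in>I. c i * w y v i)" using c(3) by (auto simp: W_def)
    also have "\<dots> = c0 * (\<Sum>t\<le>h. r t \<bullet> y t + P t (v t))
        + ((\<Sum>(t, \<alpha>)\<in>D. c (Inr (Inl (t, \<alpha>))) * (A t (y t) + B t (v t) - y (Suc t)) $ \<alpha>)
        + (\<Sum>(t, k)\<in>G. \<mu> t k * b t k (v t)))"
      unfolding I_def using fin
      by (simp add: sum.Plus w_def c0_def \<mu>_def comp_def case_prod_unfold)
    also have "(\<Sum>(t, \<alpha>)\<in>D. c (Inr (Inl (t, \<alpha>))) * (A t (y t) + B t (v t) - y (Suc t)) $ \<alpha>)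
        = (\<Sum>t\<le>h. \<Sum>\<alpha>\<in>act t. c (Inr (Inl (t, \<alpha>))) * (A t (y t) + B t (v t) - y (Suc t)) $ \<alpha>)"
      unfolding D_def by (subst sum.Sigma) auto
    also have "\<dots> = (\<Sum>t\<le>h. q t \<bullet> (A t (y t) + B t (v t) - y (Suc t)))"
    proof (intro sum.cong refl)
      fix t assume "t \<in> {..h}"
      then show "(\<Sum>\<alpha>\<in>act t. c (Inr (Inl (t, \<alpha>))) * (A t (y t) + B t (v t) - y (Suc t)) $ \<alpha>)
          = q t \<bullet> (A t (y t) + B t (v t) - y (Suc t))"
        unfolding inner_vec_def by (intro sum.mono_neutral_cong_left) (auto simp: q_def)
    qed
    also have "(\<Sum>(t, k)\<in>G. \<mu> t k * b t k (v t)) = (\<Sum>t\<le>h. \<Sum>k\<in>K t. \<mu> t k * b t k (v t))"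
      unfolding G_def using finite_K by (subst sum.Sigma) auto
    finally show ?thesis by simp
  qed
  ultimately show thesis by (rule that)
qed

text \<open>
  The vector \<open>q t\<close> is \<open>p_(t+1)\<close>. The multipliers of the control constraints are eliminated: under the
  constraint qualification, the weak maximum condition is equivalent to the last line by Farkas'
  lemma, and this form is visibly closed in \<open>(c, q)\<close>.
\<close>

definition multipliers :: "nat \<Rightarrow> (real \<times> (nat \<Rightarrow> real^'n)) set" where
  "multipliers h = {(c, q). c \<ge> 0 \<and> c + norm (q 0) = 1 \<and> (\<forall>t \<alpha>. q t $ \<alpha> \<ge> 0) \<and>
     (\<forall>t \<alpha>. \<alpha> \<notin> act t \<longrightarrow> q t $ \<alpha> = 0) \<and>
     (\<forall>t<h. \<forall>z. q t \<bullet> z = q (Suc t) \<bullet> A (Suc t) z + c * (r (Suc t) \<bullet> z)) \<and>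
     (\<forall>t\<le>h. \<forall>v\<in>N t. (\<forall>k\<in>K t. b t k v > 0) \<longrightarrow> q t \<bullet> B t v + c * P t v \<le> 0)}"

lemma finite_horizon_multipliers:
  "\<exists>c q. (c, q) \<in> multipliers h \<and> (\<forall>t>h. q t = 0)"
proof -
  obtain c0 q \<mu> where c0: "c0 \<ge> 0" and q: "\<And>t \<alpha>. q t $ \<alpha> \<ge> 0"
    and \<mu>: "\<And>t k. t \<le> h \<Longrightarrow> k \<in> K t \<Longrightarrow> \<mu> t k \<ge> 0"
    and inact: "\<And>t \<alpha>. \<alpha> \<notin> act t \<or> t > h \<Longrightarrow> q t $ \<alpha> = 0"
    and nz: "c0 \<noteq> 0 \<or> (\<exists>t\<le>h. q t \<noteq> 0) \<or> (\<exists>t\<le>h. \<exists>k\<in>K t. \<mu> t k \<noteq> 0)"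
    and st: "\<And>y v. y 0 = 0 \<Longrightarrow> (\<And>t. t > h \<Longrightarrow> y t = 0) \<Longrightarrow> (\<And>t. v t \<in> N t) \<Longrightarrow>
      c0 * (\<Sum>t\<le>h. r t \<bullet> y t + P t (v t)) + (\<Sum>t\<le>h. q t \<bullet> (A t (y t) + B t (v t) - y (Suc t)))
        + (\<Sum>t\<le>h. \<Sum>k\<in>K t. \<mu> t k * b t k (v t)) = 0"
    by (fact gordan_multipliers)
  note zero = linear_0[OF linear_P] linear_0[OF linear_A] linear_0[OF linear_B]
    linear_0[OF linear_b]
  have ae: "q t \<bullet> z = q (Suc t) \<bullet> A (Suc t) z + c0 * (r (Suc t) \<bullet> z)" if "t < h" for t z
  proof -
    \<comment> \<open>A state concentrated at time \<open>Suc t\<close> occurs twice: as the target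
      of stage \<open>t\<close> and as the state entering stage \<open>Suc t\<close>. The condition
      \<open>t < h\<close> keeps it zero after \<open>h\<close>.\<close>
    define y where "y = (\<lambda>s. if s = Suc t then z else 0)"
    have "c0 * (\<Sum>t\<le>h. r t \<bullet> y t + P t 0) + (\<Sum>t\<le>h. q t \<bullet> (A t (y t) + B t 0 - y (Suc t)))
        + (\<Sum>t\<le>h. \<Sum>k\<in>K t. \<mu> t k * b t k 0) = 0"
      using that N by (intro st) (auto simp: y_def subspace_0)
    then have "c0 * (\<Sum>t\<le>h. r t \<bullet> y t) + (\<Sum>t\<le>h. q t \<bullet> A t (y t)) - (\<Sum>t\<le>h. q t \<bullet> y (Suc t)) = 0"
      by (simp add: zero inner_diff_right sum_subtractf)
    moreover have "(\<Sum>t\<le>h. r t \<bullet> y t) = r (Suc t) \<bullet> y (Suc t)"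
      using that by (intro sum_eq_single) (auto simp: y_def)
    moreover have "(\<Sum>t\<le>h. q t \<bullet> A t (y t)) = q (Suc t) \<bullet> A (Suc t) (y (Suc t))"
      using that by (intro sum_eq_single) (auto simp: y_def zero)
    moreover have "(\<Sum>t\<le>h. q t \<bullet> y (Suc t)) = q t \<bullet> y (Suc t)"
      using that by (intro sum_eq_single) (auto simp: y_def)
    ultimately show ?thesis by (simp add: y_def)
  qed
  have wm: "q t \<bullet> B t v + c0 * P t v + (\<Sum>k\<in>K t. \<mu> t k * b t k v) = 0"
    if "t \<le> h" "v \<in> N t" for t v
  proof -
    define u where "u = (\<lambda>s. if s = t then v else 0)"
    have "c0 * (\<Sum>t\<le>h. r t \<bullet> 0 + P t (u t)) + (\<Sum>t\<le>h. q t \<bullet> (A t 0 + B t (u t) - 0))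
        + (\<Sum>t\<le>h. \<Sum>k\<in>K t. \<mu> t k * b t k (u t)) = 0"
      using that N by (intro st) (auto simp: u_def subspace_0)
    then have "c0 * (\<Sum>t\<le>h. P t (u t)) + (\<Sum>t\<le>h. q t \<bullet> B t (u t))
        + (\<Sum>t\<le>h. \<Sum>k\<in>K t. \<mu> t k * b t k (u t)) = 0"
      by (simp add: zero)
    moreover have "(\<Sum>t\<le>h. P t (u t)) = P t (u t)"
      using that by (intro sum_eq_single) (auto simp: u_def zero)
    moreover have "(\<Sum>t\<le>h. q t \<bullet> B t (u t)) = q t \<bullet> B t (u t)"
      using that by (intro sum_eq_single) (auto simp: u_def zero)
    moreover have "(\<Sum>t\<le>h. \<Sum>k\<in>K t. \<mu> t k * b t k (u t)) = (\<Sum>k\<in>K t. \<mu> t k * b t k (u t))"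
      using that by (intro sum_eq_single) (auto simp: u_def zero)
    ultimately show ?thesis by (simp add: u_def)
  qed
  \<comment> \<open>If \<open>c0\<close> and \<open>q 0\<close> vanish, the adjoint equation and
    \<open>adjoint_injective\<close> propagate the zero forward to every \<open>q t\<close>; a
    regular direction then forces all \<open>\<mu> t k\<close> to vanish, against
    \<open>nz\<close>.\<close>
  have nz': "c0 \<noteq> 0 \<or> q 0 \<noteq> 0"
  proof (rule ccontr)
    assume "\<not> ?thesis"
    then have 0: "c0 = 0" "q 0 = 0" by auto
    have qt: "q t = 0" if "t \<le> h" for t
      using that
    proof (induction t)
      case (Suc t)
      then have "q t = 0" "t < h" by auto
      then have "\<forall>z. q (Suc t) \<bullet> A (Suc t) z = 0" using ae[of t] 0 by simp
      then show ?case using q adjoint_injective by blast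
    qed (use 0 in simp)
    have "\<mu> t k = 0" if "t \<le> h" "k \<in> K t" for t k
    proof -
      obtain v where v: "v \<in> N t" "\<forall>k\<in>K t. b t k v > 0" using regular_direction by blast
      have "(\<Sum>k\<in>K t. \<mu> t k * b t k v) = 0" using wm[OF that(1) v(1)] 0 qt[OF that(1)] by simp
      then have "\<mu> t k * b t k v = 0"
        using sum_nonneg_eq_0_iff[OF finite_K, of t "\<lambda>k. \<mu> t k * b t k v"] \<mu>[OF that(1)] v(2)
          that(2) by (auto intro: mult_nonneg_nonneg less_imp_le)
      then show ?thesis using v(2) that(2) by force
    qed
    then show False using nz 0 qt by blast
  qed
  define s where "s = inverse (c0 + norm (q 0))"
  have pos: "c0 + norm (q 0) > 0" using nz' c0 by (smt (verit) zero_less_norm_iff norm_ge_zero)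
  then have s: "s > 0" by (simp add: s_def)
  have "(s * c0, \<lambda>t. s *\<^sub>R q t) \<in> multipliers h"
    unfolding multipliers_def
  proof (intro CollectI case_prodI conjI allI impI ballI)
    have "s * c0 + norm (s *\<^sub>R q 0) = s * (c0 + norm (q 0))" using s by (simp add: algebra_simps)
    then show "s * c0 + norm (s *\<^sub>R q 0) = 1" using pos by (simp add: s_def)
    show "(s *\<^sub>R q t) \<bullet> z = (s *\<^sub>R q (Suc t)) \<bullet> A (Suc t) z + s * c0 * (r (Suc t) \<bullet> z)"
      if "t < h" for t z using ae[OF that] by (simp add: algebra_simps)
    \<comment> \<open>The terms with \<open>\<mu>\<close> are nonnegative on such directions, so
      dropping them leaves an inequality free of \<open>\<mu>\<close>.\<close>
    fix t v assume "t \<le> h" "v \<in> N t" "\<forall>k\<in>K t. b t k v > 0"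
    then have "q t \<bullet> B t v + c0 * P t v \<le> 0"
      using wm[of t v] \<mu>[of t] sum_nonneg[of "K t" "\<lambda>k. \<mu> t k * b t k v"]
      by (smt (verit) mult_nonneg_nonneg)
    then have "s * (q t \<bullet> B t v + c0 * P t v) \<le> 0" using s by (simp add: mult_le_0_iff)
    then show "(s *\<^sub>R q t) \<bullet> B t v + s * c0 * P t v \<le> 0" by (simp add: algebra_simps)
  qed (use s c0 q inact in auto)
  moreover have "\<forall>t>h. s *\<^sub>R q t = 0" using inact by (simp add: vec_eq_iff)
  ultimately show ?thesis by blast
qed

text \<open>On the compact set of nonnegative unit vectors the transpose never vanishes, by
  \<open>adjoint_injective\<close>, so its norm has a positive minimum there; homogeneity does the
  rest.\<close>

lemma adjoint_bounded_below:
  "\<exists>C\<ge>0. \<forall>q. (\<forall>\<alpha>. q $ \<alpha> \<ge> 0) \<longrightarrow> norm q \<le> C * norm (adjoint (A (Suc t)) q)"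
proof -
  define S :: "(real^'n) set" where "S = {q. \<forall>\<alpha>. q $ \<alpha> \<ge> 0} \<inter> sphere 0 1"
  have lin: "linear (adjoint (A (Suc t)))" by (rule adjoint_linear[OF linear_A])
  have "closed {q :: real^'n. \<forall>\<alpha>. q $ \<alpha> \<ge> 0}"
    by (intro closed_Collect_all closed_Collect_le continuous_intros)
  then have S: "compact S" unfolding S_def by (simp add: closed_Int_compact)
  have cont: "continuous_on S (\<lambda>q. norm (adjoint (A (Suc t)) q))"
    by (intro continuous_on_norm linear_continuous_on lin[unfolded linear_conv_bounded_linear])
  show ?thesis
  proof (cases "S = {}")
    case True
    have "q = 0" if "\<forall>\<alpha>. q $ \<alpha> \<ge> 0" for q :: "real^'n"
    proof (rule ccontr)
      assume "q \<noteq> 0"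
      then have "q /\<^sub>R norm q \<in> S" using that by (simp add: S_def)
      then show False using True by simp
    qed
    then show ?thesis by (intro exI[of _ 0]) auto
  next
    case False
    obtain q0 where q0: "q0 \<in> S"
      "\<And>q. q \<in> S \<Longrightarrow> norm (adjoint (A (Suc t)) q0) \<le> norm (adjoint (A (Suc t)) q)"
      using continuous_attains_inf[OF S False cont] by blast
    define m where "m = norm (adjoint (A (Suc t)) q0)"
    have "m \<noteq> 0"
    proof
      assume "m = 0"
      then have "\<forall>z. q0 \<bullet> A (Suc t) z = 0"
        using adjoint_works[OF linear_A[of "Suc t"], of _ q0] by (simp add: m_def inner_commute)
      then have "q0 = 0" using q0(1) adjoint_injective by (auto simp: S_def)
      then show False using q0(1) by (simp add: S_def)
    qed
    then have m: "m > 0" by (simp add: m_def)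
    have "norm q \<le> (1 / m) * norm (adjoint (A (Suc t)) q)" if "\<forall>\<alpha>. q $ \<alpha> \<ge> 0" for q
    proof (cases "q = 0")
      case False
      then have "q /\<^sub>R norm q \<in> S" using that by (simp add: S_def)
      then have "m \<le> norm (adjoint (A (Suc t)) (q /\<^sub>R norm q))" using q0(2) by (simp add: m_def)
      also have "\<dots> = norm (adjoint (A (Suc t)) q) / norm q"
        by (simp add: linear_scale[OF lin] divide_inverse_commute)
      finally show ?thesis using m False by (simp add: field_simps)
    qed (use linear_0[OF lin] in simp)
    then show ?thesis using m by (intro exI[of _ "1 / m"]) auto
  qed
qed

text \<open>The adjoint equation expresses the image of \<open>q (Suc t)\<close> under the transpose
  through \<open>q t\<close>, so a bound passes from \<open>t\<close> to \<open>Suc t\<close>. It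
  depends on \<open>t\<close> but not on \<open>h\<close>.\<close>

lemma multipliers_bounded:
  "\<exists>bd. \<forall>h c q. (c, q) \<in> multipliers h \<longrightarrow> (\<forall>t\<le>h. norm (q t) \<le> bd t)"
proof -
  obtain C where C: "\<And>t. C t \<ge> 0"
    "\<And>t q. (\<forall>\<alpha>. q $ \<alpha> \<ge> 0) \<Longrightarrow> norm q \<le> C t * norm (adjoint (A (Suc t)) q)"
    using adjoint_bounded_below by metis
  \<comment> \<open>The start 1 comes from \<open>c + norm (q 0) = 1\<close>; the same normalization
    gives \<open>c <= 1\<close>, which bounds the inhomogeneous term by
    \<open>norm (r (Suc t))\<close>.\<close>
  define bd :: "nat \<Rightarrow> real" where "bd = rec_nat 1 (\<lambda>t bt. C t * (bt + norm (r (Suc t))))"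
  have bd: "bd 0 = 1" "\<And>t. bd (Suc t) = C t * (bd t + norm (r (Suc t)))" by (simp_all add: bd_def)
  have "norm (q t) \<le> bd t" if m: "(c, q) \<in> multipliers h" and "t \<le> h" for c q h t
    using that(2)
  proof (induction t)
    case 0
    then show ?case using m by (simp add: bd multipliers_def)
  next
    case (Suc t)
    have c: "0 \<le> c" "c \<le> 1" using m norm_ge_zero[of "q 0"] unfolding multipliers_def
      by (auto simp del: norm_ge_zero)
    have "q t \<bullet> z = (adjoint (A (Suc t)) (q (Suc t)) + c *\<^sub>R r (Suc t)) \<bullet> z" for z
    proof -
      have "t < h" using Suc.prems by simp
      then have "q t \<bullet> z = q (Suc t) \<bullet> A (Suc t) z + c * (r (Suc t) \<bullet> z)"
        using m unfolding multipliers_def by blast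
      moreover have "q (Suc t) \<bullet> A (Suc t) z = adjoint (A (Suc t)) (q (Suc t)) \<bullet> z"
        using adjoint_works[OF linear_A[of "Suc t"], of z "q (Suc t)"] by (simp add: inner_commute)
      ultimately show ?thesis by (simp add: inner_add_left)
    qed
    then have "q t = adjoint (A (Suc t)) (q (Suc t)) + c *\<^sub>R r (Suc t)"
      by (subst vector_eq_rdot[symmetric]) blast
    then have "norm (adjoint (A (Suc t)) (q (Suc t))) = norm (q t - c *\<^sub>R r (Suc t))" by simp
    also have "\<dots> \<le> norm (q t) + norm (c *\<^sub>R r (Suc t))" by (rule norm_triangle_ineq4)
    also have "\<dots> \<le> bd t + norm (r (Suc t))"
      using Suc c by (intro add_mono) (auto simp: mult_left_le_one_le)
    finally have "C t * norm (adjoint (A (Suc t)) (q (Suc t))) \<le> bd (Suc t)"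
      unfolding bd using C(1) by (intro mult_left_mono)
    moreover have "norm (q (Suc t)) \<le> C t * norm (adjoint (A (Suc t)) (q (Suc t)))"
      using m by (intro C(2)) (simp add: multipliers_def)
    ultimately show ?case by simp
  qed
  then show ?thesis by blast
qed

text \<open>The strict inequalities bear on \<open>v\<close> alone; in \<open>(c, q)\<close> there
  are only equations and weak inequalities between functions continuous for the product
  topology.\<close>

lemma closed_multipliers: "closed (multipliers h)"
proof -
  have 1: "continuous_on UNIV (\<lambda>z :: real \<times> (nat \<Rightarrow> real^'n). snd z t)" for t
    by (rule continuous_on_compose2[OF continuous_on_product_coordinates])
      (auto intro: continuous_intros)
  have "multipliers h = {z. fst z \<ge> 0 \<and> fst z + norm (snd z 0) = 1 \<and> (\<forall>t \<alpha>. snd z t $ \<alpha> \<ge> 0) \<and>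
     (\<forall>t \<alpha>. \<alpha> \<notin> act t \<longrightarrow> snd z t $ \<alpha> = 0) \<and>
     (\<forall>t. t < h \<longrightarrow> (\<forall>w. snd z t \<bullet> w = snd z (Suc t) \<bullet> A (Suc t) w + fst z * (r (Suc t) \<bullet> w))) \<and>
     (\<forall>t. t \<le> h \<longrightarrow> (\<forall>v. v \<in> N t \<longrightarrow> (\<forall>k\<in>K t. b t k v > 0) \<longrightarrow>
       snd z t \<bullet> B t v + fst z * P t v \<le> 0))}"
    by (auto simp: multipliers_def)
  also have "closed \<dots>"
    by (intro closed_Collect_conj closed_Collect_all closed_Collect_imp open_Collect_const
        closed_Collect_le closed_Collect_eq continuous_intros 1)
  finally show ?thesis .
qed

text \<open>The sets \<open>multipliers h\<close> decrease with \<open>h\<close>, so the finite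
  intersection property needs only one finite-horizon multiplier at a time, extended by its zero
  tail.\<close>

lemma infinite_horizon_multipliers: "\<exists>c q. \<forall>h. (c, q) \<in> multipliers h"
proof -
  obtain bd where bd: "\<And>h c q t. (c, q) \<in> multipliers h \<Longrightarrow> t \<le> h \<Longrightarrow> norm (q t) \<le> bd t"
    using multipliers_bounded by blast
  \<comment> \<open>The absolute value makes every radius nonnegative, so that the zero tail lies in
    the product.\<close>
  define Q where "Q = {0..1::real} \<times> (\<Pi>\<^sub>E t\<in>UNIV. cball (0::real^'n) \<bar>bd t\<bar>)"
  have "compact (\<Pi>\<^sub>E t\<in>UNIV. cball (0::real^'n) \<bar>bd t\<bar>)"
    using compactin_PiE[of "\<lambda>_. euclidean" UNIV "\<lambda>t. cball (0::real^'n) \<bar>bd t\<bar>"]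
    by (simp add: euclidean_product_topology)
  then have Q: "compact Q" unfolding Q_def by (intro compact_Times) auto
  have anti: "multipliers h' \<subseteq> multipliers h" if "h \<le> h'" for h h'
    using that by (auto simp: multipliers_def)
  have "Q \<inter> (\<Inter>h\<in>UNIV. multipliers h) \<noteq> {}"
  proof (rule compact_imp_fip_image[OF Q])
    show "closed (multipliers h)" for h by (rule closed_multipliers)
    fix H :: "nat set" assume "finite H"
    define h where "h = Max (insert 0 H)"
    obtain c q where cq: "(c, q) \<in> multipliers h" "\<forall>t>h. q t = 0"
      using finite_horizon_multipliers by blast
    have "norm (q t) \<le> \<bar>bd t\<bar>" for t
      using bd[OF cq(1), of t] cq(2) by (cases "t \<le> h") auto
    moreover have "c \<in> {0..1}" using cq(1) norm_ge_zero[of "q 0"]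
      unfolding multipliers_def by (auto simp del: norm_ge_zero)
    ultimately have "(c, q) \<in> Q" by (auto simp: Q_def)
    moreover have "(c, q) \<in> multipliers i" if "i \<in> H" for i
      using anti[of i h] that cq(1) \<open>finite H\<close> by (auto simp: h_def)
    ultimately show "Q \<inter> (\<Inter>h\<in>H. multipliers h) \<noteq> {}" by blast
  qed
  then show ?thesis by auto
qed

end

subsection \<open>Perturbations along a direction\<close>

text \<open>The corrected control directions depend on the step length. Frechet differentiability
  tolerates this because its remainder is uniform in the direction.\<close>

lemma difference_quotient_tendsto:
  fixes F :: "'a::real_normed_vector \<Rightarrow> real"
  assumes F: "(F has_derivative F') (at a)"
    and s: "\<And>n. s n > 0" "s \<longlonglongrightarrow> 0" and z: "z \<longlonglongrightarrow> z0"
  shows "(\<lambda>n. (F (a + s n *\<^sub>R z n) - F a) / s n) \<longlonglongrightarrow> F' z0"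
proof -
  interpret F': bounded_linear F' using F by (rule has_derivative_bounded_linear)
  obtain C where C: "C > 0" "\<And>n. norm (z n) \<le> C"
    using z by (metis BseqE convergent_imp_Bseq convergentI)
  have "(\<lambda>n. (F (a + s n *\<^sub>R z n) - F a) / s n - F' (z n)) \<longlonglongrightarrow> 0"
  proof (rule LIMSEQ_I)
    fix r :: real assume "r > 0"
    \<comment> \<open>\<open>C\<close> bounds all directions, so this tolerance makes the remainder
      at most \<open>r / 2 * s n\<close>, which is strictly below \<open>r * s n\<close>.\<close>
    then have "r / (2 * C) > 0" using C by simp
    then obtain \<delta> where \<delta>: "\<delta> > 0"
      "\<And>y. norm (y - a) < \<delta> \<Longrightarrow> norm (F y - F a - F' (y - a)) \<le> r / (2 * C) * norm (y - a)"
      using F unfolding has_derivative_at_alt by blast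
    have "\<forall>\<^sub>F n in sequentially. s n < \<delta> / C"
      using s(2) \<delta>(1) C(1) by (intro order_tendstoD(2)) auto
    then obtain N where N: "\<And>n. n \<ge> N \<Longrightarrow> s n < \<delta> / C"
      unfolding eventually_sequentially by blast
    have "norm ((F (a + s n *\<^sub>R z n) - F a) / s n - F' (z n) - 0) < r" if "n \<ge> N" for n
    proof -
      have le: "norm (s n *\<^sub>R z n) \<le> s n * C" using s(1)[of n] C(2)[of n] by simp
      also have "\<dots> < \<delta>" using N[OF that] C(1) by (simp add: field_simps)
      finally have "norm (F (a + s n *\<^sub>R z n) - F a - F' (s n *\<^sub>R z n))
          \<le> r / (2 * C) * norm (s n *\<^sub>R z n)"
        using \<delta>(2)[of "a + s n *\<^sub>R z n"] by simp
      also have "\<dots> \<le> r / (2 * C) * (s n * C)"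
        using le \<open>r / (2 * C) > 0\<close> by (intro mult_left_mono) auto
      also have "\<dots> < r * s n" using s(1)[of n] C(1) \<open>r > 0\<close> by simp
      finally have "\<bar>F (a + s n *\<^sub>R z n) - F a - s n * F' (z n)\<bar> < r * s n"
        by (simp add: F'.scaleR)
      then have "\<bar>F (a + s n *\<^sub>R z n) - F a - s n * F' (z n)\<bar> / s n < r"
        using s(1)[of n] by (simp add: field_simps)
      moreover have "(F (a + s n *\<^sub>R z n) - F a) / s n - F' (z n)
          = (F (a + s n *\<^sub>R z n) - F a - s n * F' (z n)) / s n"
        using s(1)[of n] by (simp add: field_simps)
      ultimately show ?thesis using s(1)[of n] by (simp add: abs_divide)
    qed
    then show "\<exists>no. \<forall>n\<ge>no. norm ((F (a + s n *\<^sub>R z n) - F a) / s n - F' (z n) - 0) < r"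
      by blast
  qed
  moreover have "(\<lambda>n. F' (z n)) \<longlonglongrightarrow> F' z0" using z by (rule F'.tendsto)
  ultimately show ?thesis using tendsto_add by fastforce
qed

text \<open>
  The functions \<open>e j\<close> are differentiable at \<open>a\<close> only, so the implicit function theorem is not available.
  Writing \<open>w = v + w'\<close> with \<open>w'\<close> in the span of the dual vectors \<open>d j\<close>, the equations
  \<open>e j (a + s w) = 0\<close> form a fixed point problem for \<open>w'\<close> in a small ball.
\<close>

lemma correct_to_zero_set:
  fixes e :: "'j \<Rightarrow> 'a::euclidean_space \<Rightarrow> real"
  assumes L: "finite L" and der: "\<And>j. j \<in> L \<Longrightarrow> (e j has_derivative blinfun_apply (E j)) (at a)"
    and d: "\<forall>i\<in>L. \<forall>j\<in>L. E i (d j) = (if i = j then 1 else 0)"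
    and cont: "\<And>j. j \<in> L \<Longrightarrow> \<exists>V. open V \<and> a \<in> V \<and> continuous_on V (e j)"
    and zero: "\<And>j. j \<in> L \<Longrightarrow> e j a = 0" and v: "\<And>j. j \<in> L \<Longrightarrow> E j v = 0" and "\<epsilon> > 0"
  shows "\<forall>\<^sub>F s in at_right 0. \<exists>w. norm (w - v) \<le> \<epsilon> \<and> (\<forall>j\<in>L. e j (a + s *\<^sub>R w) = 0)"
proof -
  \<comment> \<open>Corrections live in a ball of the span of the dual vectors: compact and convex,
    as Brouwer requires, with the \<open>E j\<close> as coordinates.\<close>
  define S where "S = cball 0 \<epsilon> \<inter> span (d ` L)"
  \<comment> \<open>\<open>D\<close> bounds the sum of the norms of the \<open>d j\<close>, the 1
    keeping it positive, and \<open>R\<close> bounds \<open>norm (v + w)\<close> for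
    \<open>w\<close> in \<open>S\<close>. The tolerance \<open>\<epsilon> / (R * D)\<close> below is
    chosen so that the map \<open>T\<close> sends \<open>S\<close> into itself.\<close>
  define D where "D = (\<Sum>j\<in>L. norm (d j)) + 1"
  define R where "R = norm v + \<epsilon>"
  have D: "D > 0" unfolding D_def by (intro add_nonneg_pos sum_nonneg) auto
  have R: "R > 0" using \<open>\<epsilon> > 0\<close> by (simp add: R_def add_nonneg_pos)
  have \<eta>: "\<epsilon> / (R * D) > 0" using D R \<open>\<epsilon> > 0\<close> by simp
  have S: "compact S" "convex S"
    unfolding S_def by (auto intro!: compact_Int_closed convex_Int closed_span
        subspace_imp_convex[OF subspace_span])
  have "0 \<in> S" unfolding S_def using \<open>\<epsilon> > 0\<close> span_zero[of "d ` L"] by simp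
  then have S0: "S \<noteq> {}" by blast
  have dec: "w = (\<Sum>j\<in>L. E j w *\<^sub>R d j)" if "w \<in> span (d ` L)" for w
    using that
  proof (induction rule: span_induct_alt)
    case base
    then show ?case by simp
  next
    case (step c x y)
    then obtain i where i: "i \<in> L" "x = d i" by blast
    have "(\<Sum>j\<in>L. E j x *\<^sub>R d j) = (\<Sum>j\<in>L. if i = j then d j else 0)"
      unfolding i using d i by (intro sum.cong) auto
    then have x: "(\<Sum>j\<in>L. E j x *\<^sub>R d j) = x" using L i by simp
    have "(\<Sum>j\<in>L. E j (c *\<^sub>R x + y) *\<^sub>R d j)
        = c *\<^sub>R (\<Sum>j\<in>L. E j x *\<^sub>R d j) + (\<Sum>j\<in>L. E j y *\<^sub>R d j)"
      by (simp add: blinfun.add_right blinfun.scaleR_right scaleR_left_distrib sum.distrib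
          scaleR_sum_right)
    then show ?case using x step by simp
  qed
  have "\<forall>j\<in>L. \<exists>\<delta>>0. \<forall>y. norm (y - a) < \<delta> \<longrightarrow>
      \<bar>e j y - E j (y - a)\<bar> \<le> \<epsilon> / (R * D) * norm (y - a) \<and> isCont (e j) y"
  proof
    fix j assume j: "j \<in> L"
    obtain \<delta> where \<delta>: "\<delta> > 0" "\<And>y. norm (y - a) < \<delta> \<Longrightarrow>
        norm (e j y - e j a - E j (y - a)) \<le> \<epsilon> / (R * D) * norm (y - a)"
      using der[OF j] \<eta> unfolding has_derivative_at_alt by blast
    obtain V where V: "open V" "a \<in> V" "continuous_on V (e j)" using cont[OF j] by blast
    obtain r where r: "r > 0" "ball a r \<subseteq> V" using V openE by blast
    have "\<bar>e j y - E j (y - a)\<bar> \<le> \<epsilon> / (R * D) * norm (y - a) \<and> isCont (e j) y"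
      if "norm (y - a) < min \<delta> r" for y
    proof -
      have "y \<in> V" using that r by (auto simp: dist_norm norm_minus_commute)
      then have "isCont (e j) y" using V continuous_on_eq_continuous_at by blast
      then show ?thesis using \<delta>(2)[of y] that zero[OF j] by simp
    qed
    then show "\<exists>\<delta>>0. \<forall>y. norm (y - a) < \<delta> \<longrightarrow>
      \<bar>e j y - E j (y - a)\<bar> \<le> \<epsilon> / (R * D) * norm (y - a) \<and> isCont (e j) y"
      using \<delta>(1) r(1) by (intro exI[of _ "min \<delta> r"]) auto
  qed
  then obtain \<delta> where \<delta>: "\<And>j. j \<in> L \<Longrightarrow> \<delta> j > 0"
    "\<And>j y. j \<in> L \<Longrightarrow> norm (y - a) < \<delta> j \<Longrightarrow>
      \<bar>e j y - E j (y - a)\<bar> \<le> \<epsilon> / (R * D) * norm (y - a) \<and> isCont (e j) y"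
    by (auto simp: bchoice_iff)
  have "\<forall>\<^sub>F s in at_right 0. s * R < \<delta> j" if "j \<in> L" for j
  proof -
    have "((\<lambda>s. s * R) \<longlongrightarrow> 0 * R) (at_right 0)" by (intro tendsto_intros)
    then show ?thesis using \<delta>(1)[OF that] by (intro order_tendstoD(2)) auto
  qed
  then have "\<forall>\<^sub>F s in at_right 0. \<forall>j\<in>L. s * R < \<delta> j"
    using L by (simp add: eventually_ball_finite)
  moreover have "\<forall>\<^sub>F s in at_right (0::real). s > 0"
    by (simp add: eventually_at_right_less)
  ultimately show ?thesis
  proof eventually_elim
    case (elim s)
    \<comment> \<open>A Newton-type step with the derivative at \<open>a\<close>. Since
      \<open>E j v = 0\<close>, the coefficients of \<open>T w\<close> along the \<open>d j\<close>
      are, up to sign, the linearization errors divided by \<open>s\<close>; a fixed point makes all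
      \<open>e j\<close> vanish, as applying each \<open>E i\<close> shows.\<close>
    define T where "T = (\<lambda>w. w - (\<Sum>j\<in>L. (e j (a + s *\<^sub>R (v + w)) / s) *\<^sub>R d j))"
    have vw: "norm (v + w) \<le> R" if "w \<in> S" for w
      using that norm_triangle_ineq[of v w] by (simp add: S_def R_def)
    have near: "norm (a + s *\<^sub>R (v + w) - a) < \<delta> j" if "w \<in> S" "j \<in> L" for w j
    proof -
      have "norm (s *\<^sub>R (v + w)) \<le> s * R" using vw[OF that(1)] elim by simp
      then show ?thesis using elim(1) that(2) by fastforce
    qed
    have "continuous_on S T" unfolding T_def
    proof (intro continuous_intros continuous_on_sum)
      fix j assume j: "j \<in> L"
      have "continuous_on ((\<lambda>w. a + s *\<^sub>R (v + w)) ` S) (e j)"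
        using \<delta>(2)[OF j near[OF _ j]] by (auto intro!: continuous_at_imp_continuous_on)
      then show "continuous_on S (\<lambda>w. e j (a + s *\<^sub>R (v + w)))"
        by (rule continuous_on_compose2) (auto intro!: continuous_intros)
    qed (use elim in auto)
    moreover have "T w \<in> S" if w: "w \<in> S" for w
    proof -
      have wS: "w \<in> span (d ` L)" using w by (simp add: S_def)
      have *: "\<bar>E j w - e j (a + s *\<^sub>R (v + w)) / s\<bar> \<le> \<epsilon> / D" if j: "j \<in> L" for j
      proof -
        have "\<bar>e j (a + s *\<^sub>R (v + w)) - E j (s *\<^sub>R (v + w))\<bar> \<le> \<epsilon> / (R * D) * norm (s *\<^sub>R (v + w))"
          using \<delta>(2)[OF j near[OF w j]] by simp
        also have "\<dots> \<le> \<epsilon> / (R * D) * (s * R)"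
          using vw[OF w] elim \<eta> by (intro mult_left_mono) auto
        also have "\<dots> = \<epsilon> / D * s" using R by simp
        finally have "\<bar>s * E j w - e j (a + s *\<^sub>R (v + w))\<bar> \<le> \<epsilon> / D * s"
          using v[OF j] by (simp add: blinfun.scaleR_right blinfun.add_right abs_minus_commute)
        then have "\<bar>s * E j w - e j (a + s *\<^sub>R (v + w))\<bar> / s \<le> \<epsilon> / D"
          using elim by (simp add: field_simps)
        moreover have "E j w - e j (a + s *\<^sub>R (v + w)) / s = (s * E j w - e j (a + s *\<^sub>R (v + w))) / s"
          using elim by (simp add: field_simps)
        ultimately show ?thesis using elim by (simp add: abs_divide)
      qed
      have "T w = (\<Sum>j\<in>L. (E j w - e j (a + s *\<^sub>R (v + w)) / s) *\<^sub>R d j)"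
        unfolding T_def by (subst dec[OF wS]) (simp add: scaleR_left_diff_distrib sum_subtractf)
      then have "norm (T w) \<le> (\<Sum>j\<in>L. \<epsilon> / D * norm (d j))"
        using * by (auto intro!: sum_norm_le mult_right_mono simp del: times_divide_eq_left)
      also have "\<dots> \<le> \<epsilon> / D * D"
        unfolding sum_distrib_left[symmetric] using D \<open>\<epsilon> > 0\<close>
        by (intro mult_left_mono) (auto simp: D_def)
      finally have "norm (T w) \<le> \<epsilon>" using D by simp
      moreover have "T w \<in> span (d ` L)" unfolding T_def
        by (intro span_diff wS span_sum span_scale span_base) auto
      ultimately show ?thesis by (simp add: S_def)
    qed
    ultimately obtain w where w: "w \<in> S" "T w = w"
      using brouwer[OF S S0, of T] by blast
    have 0: "(\<Sum>j\<in>L. (e j (a + s *\<^sub>R (v + w)) / s) *\<^sub>R d j) = 0" using w(2) by (simp add: T_def)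
    have "e i (a + s *\<^sub>R (v + w)) = 0" if i: "i \<in> L" for i
    proof -
      have "0 = E i (\<Sum>j\<in>L. (e j (a + s *\<^sub>R (v + w)) / s) *\<^sub>R d j)"
        using 0 by simp
      also have "\<dots> = (\<Sum>j\<in>L. e j (a + s *\<^sub>R (v + w)) / s * E i (d j))"
        by (simp add: blinfun.sum_right blinfun.scaleR_right)
      also have "\<dots> = (\<Sum>j\<in>L. if i = j then e j (a + s *\<^sub>R (v + w)) / s else 0)"
        using d i by (intro sum.cong) auto
      also have "\<dots> = e i (a + s *\<^sub>R (v + w)) / s" using i L by simp
      finally show ?thesis using elim by simp
    qed
    then show ?case using w(1) by (intro exI[of _ "v + w"]) (simp add: S_def)
  qed
qed

subsection \<open>Differentials\<close>

lemma gateaux_limit: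
  "gateaux_differentiable \<Phi> a \<Longrightarrow> (diff_quot \<Phi> a v \<longlongrightarrow> dir_deriv \<Phi> a v) (at 0)"
  unfolding gateaux_differentiable_def dir_deriv_def
  by (metis tendsto_Lim trivial_limit_at)

lemma dir_deriv_eqI: "(diff_quot \<Phi> a v \<longlongrightarrow> L) (at 0) \<Longrightarrow> dir_deriv \<Phi> a v = L"
  unfolding dir_deriv_def by (intro tendsto_Lim trivial_limit_at)

lemma D_G_apply_eqI:
  fixes \<Phi> :: "'a::euclidean_space \<Rightarrow> 'b::real_normed_vector"
  assumes "linear L" "\<And>v. (diff_quot \<Phi> a v \<longlongrightarrow> L v) (at 0)"
  shows "blinfun_apply (D_G \<Phi> a) = L"
proof -
  have "dir_deriv \<Phi> a = L" using assms(2) by (intro ext dir_deriv_eqI)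
  then show ?thesis unfolding D_G_def
    using assms(1) by (simp add: bounded_linear_Blinfun_apply linear_conv_bounded_linear)
qed

lemma D_F_apply:
  assumes "(\<Phi> has_derivative L) (at a)"
  shows "blinfun_apply (D_F \<Phi> a) = L"
proof -
  have "frechet_derivative \<Phi> (at a) = L" by (rule frechet_derivative_at[OF assms, symmetric])
  then show ?thesis unfolding D_F_def
    using assms by (simp add: bounded_linear_Blinfun_apply has_derivative_bounded_linear)
qed

lemma has_derivative_imp_diff_quot_tendsto:
  assumes "(\<Phi> has_derivative L) (at a)"
  shows "(diff_quot \<Phi> a v \<longlongrightarrow> L v) (at 0)"
proof -
  have "((\<lambda>s::real. a + s *\<^sub>R v) has_derivative (\<lambda>s. s *\<^sub>R v)) (at 0)"
    by (auto intro!: derivative_eq_intros)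
  then have "((\<lambda>s. \<Phi> (a + s *\<^sub>R v)) has_derivative (\<lambda>s. L (s *\<^sub>R v))) (at 0)"
    using has_derivative_compose[of "\<lambda>s. a + s *\<^sub>R v" "\<lambda>s. s *\<^sub>R v" 0 UNIV \<Phi> L] assms by simp
  then have lim: "((\<lambda>s. norm (\<Phi> (a + s *\<^sub>R v) - \<Phi> a - s *\<^sub>R L v) / \<bar>s\<bar>) \<longlongrightarrow> 0) (at 0)"
    using assms by (simp add: has_derivative_iff_norm linear_scale has_derivative_linear)
  have "norm (\<Phi> (a + s *\<^sub>R v) - \<Phi> a - s *\<^sub>R L v) / \<bar>s\<bar> = norm (diff_quot \<Phi> a v s - L v)"
    if "s \<noteq> 0" for s
  proof -
    have "diff_quot \<Phi> a v s - L v = (1 / s) *\<^sub>R (\<Phi> (a + s *\<^sub>R v) - \<Phi> a - s *\<^sub>R L v)"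
      using that by (simp add: diff_quot_def scaleR_diff_right)
    then show ?thesis by simp
  qed
  then have "((\<lambda>s. norm (diff_quot \<Phi> a v s - L v)) \<longlongrightarrow> 0) (at 0)"
    by (intro Lim_transform_eventually[OF lim]) (simp add: eventually_at_filter)
  then show ?thesis by (rule LIM_zero_cancel[OF tendsto_norm_zero_cancel])
qed

lemma has_derivative_imp_gateaux_differentiable:
  assumes "(\<Phi> has_derivative L) (at a)"
  shows "gateaux_differentiable \<Phi> a"
proof -
  have "dir_deriv \<Phi> a = L"
    using assms by (intro ext dir_deriv_eqI has_derivative_imp_diff_quot_tendsto)
  then show ?thesis unfolding gateaux_differentiable_def
    using has_derivative_imp_diff_quot_tendsto[OF assms] has_derivative_linear[OF assms] by auto
qed

text \<open>Differentiability is assumed coordinate by coordinate, so the joint derivative is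
  assembled from coordinates; the partial Gateaux derivatives are its restrictions to the two
  factors.\<close>

lemma joint_gateaux_derivative:
  fixes F :: "(real^'n) \<times> (real^'d) \<Rightarrow> real^'m"
  assumes "\<And>\<alpha>. gateaux_differentiable (\<lambda>z. F z $ \<alpha>) (x, u)"
  defines "F' \<equiv> \<lambda>z. \<chi> \<alpha>. dir_deriv (\<lambda>w. F w $ \<alpha>) (x, u) z"
  shows "linear F'" and "blinfun_apply (D_G1 F (x, u)) y = F' (y, 0)"
    and "blinfun_apply (D_G2 F (x, u)) v = F' (0, v)"
proof -
  have lin: "linear (dir_deriv (\<lambda>w. F w $ \<alpha>) (x, u))" for \<alpha>
    using assms(1) by (simp add: gateaux_differentiable_def)
  show F': "linear F'"
    by (rule linearI)
      (simp_all add: F'_def vec_eq_iff linear_add[OF lin] linear_scale[OF lin])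
  have lim: "(diff_quot F (x, u) z \<longlongrightarrow> F' z) (at 0)" for z
  proof (rule vec_tendstoI)
    fix \<alpha>
    have "(\<lambda>s. diff_quot F (x, u) z s $ \<alpha>) = diff_quot (\<lambda>w. F w $ \<alpha>) (x, u) z"
      by (simp add: diff_quot_def fun_eq_iff)
    then show "((\<lambda>s. diff_quot F (x, u) z s $ \<alpha>) \<longlongrightarrow> F' z $ \<alpha>) (at 0)"
      using gateaux_limit[OF assms(1)] by (simp add: F'_def)
  qed
  have "blinfun_apply (D_G (\<lambda>x. F (x, u)) x) = (\<lambda>y. F' (y, 0))"
  proof (rule D_G_apply_eqI)
    show "linear (\<lambda>y. F' (y, 0))"
      by (rule linearI) (simp_all add: linear_add[OF F', symmetric] linear_scale[OF F', symmetric])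
    have "diff_quot (\<lambda>x. F (x, u)) x y = diff_quot F (x, u) (y, 0)" for y
      by (simp add: diff_quot_def fun_eq_iff)
    then show "(diff_quot (\<lambda>x. F (x, u)) x y \<longlongrightarrow> F' (y, 0)) (at 0)" for y using lim by simp
  qed
  then show "blinfun_apply (D_G1 F (x, u)) y = F' (y, 0)" by (simp add: D_G1_def)
  have "blinfun_apply (D_G (\<lambda>u. F (x, u)) u) = (\<lambda>v. F' (0, v))"
  proof (rule D_G_apply_eqI)
    show "linear (\<lambda>v. F' (0, v))"
      by (rule linearI) (simp_all add: linear_add[OF F', symmetric] linear_scale[OF F', symmetric])
    have "diff_quot (\<lambda>u. F (x, u)) u v = diff_quot F (x, u) (0, v)" for v
      by (simp add: diff_quot_def fun_eq_iff)
    then show "(diff_quot (\<lambda>u. F (x, u)) u v \<longlongrightarrow> F' (0, v)) (at 0)" for v using lim by simp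
  qed
  then show "blinfun_apply (D_G2 F (x, u)) v = F' (0, v)" by (simp add: D_G2_def)
qed

lemma partial_frechet_derivatives:
  fixes \<Phi> :: "(real^'n) \<times> (real^'d) \<Rightarrow> real"
  assumes "(\<Phi> has_derivative L) (at (x, u))"
  shows "blinfun_apply (D_F1 \<Phi> (x, u)) y = L (y, 0)"
    and "blinfun_apply (D_F2 \<Phi> (x, u)) v = L (0, v)"
proof -
  have "((\<lambda>x. (x, u)) has_derivative (\<lambda>y. (y, 0))) (at x)"
    by (auto intro!: derivative_eq_intros)
  from has_derivative_compose[OF this assms]
  have "((\<lambda>x. \<Phi> (x, u)) has_derivative (\<lambda>y. L (y, 0))) (at x)" .
  then show "blinfun_apply (D_F1 \<Phi> (x, u)) y = L (y, 0)" by (simp add: D_F1_def D_F_apply)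
  have "((\<lambda>u. (x, u)) has_derivative (\<lambda>v. (0, v))) (at u)"
    by (auto intro!: derivative_eq_intros)
  from has_derivative_compose[OF this assms]
  have "((\<lambda>u. \<Phi> (x, u)) has_derivative (\<lambda>v. L (0, v))) (at u)" .
  then show "blinfun_apply (D_F2 \<Phi> (x, u)) v = L (0, v)" by (simp add: D_F2_def D_F_apply)
qed

subsection \<open>Variations of a solution\<close>

lemma lsc_at_within_sequentially:
  assumes "lsc_at_within \<Phi> a S" "c < \<Phi> a" "z \<longlonglongrightarrow> a" "\<forall>\<^sub>F n in sequentially. z n \<in> S"
  shows "\<forall>\<^sub>F n in sequentially. c < \<Phi> (z n)"
proof -
  have "\<forall>\<^sub>F z in nhds a. z \<noteq> a \<longrightarrow> z \<in> S \<longrightarrow> c < \<Phi> z"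
    using assms(1,2) unfolding lsc_at_within_def eventually_at_filter by blast
  then have "\<forall>\<^sub>F n in sequentially. z n \<noteq> a \<longrightarrow> z n \<in> S \<longrightarrow> c < \<Phi> (z n)"
    using assms(3) by (rule eventually_compose_filterlim)
  \<comment> \<open>The punctured filter in \<open>lsc_at_within\<close> is silent where
    \<open>z n = a\<close>; there \<open>c < \<Phi> a\<close> applies.\<close>
  with assms(4) show ?thesis by eventually_elim (use assms(2) in auto)
qed

text \<open>For a competitor with the same tail the gap is constant from \<open>h\<close> on, so its
  limsup, its liminf and, for the first problem, the difference of the series are one finite sum;
  all three notions of optimality give the same inequality.\<close>

lemma solves_P_finite_horizon:
  assumes sol: "solves_P l X U f \<sigma> \<phi> (xh, uh)"
    and adm: "(x, u) \<in> Adm_i X U f \<sigma>" and tail: "\<And>t. t > h \<Longrightarrow> x t = xh t \<and> u t = uh t"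
  shows "(\<Sum>t\<le>h. \<phi> t (x t, u t)) \<le> (\<Sum>t\<le>h. \<phi> t (xh t, uh t))"
proof (rule ccontr)
  define D where "D = (\<Sum>t\<le>h. \<phi> t (xh t, uh t)) - (\<Sum>t\<le>h. \<phi> t (x t, u t))"
  assume "\<not> ?thesis"
  then have D: "D < 0" by (simp add: D_def)
  have gap: "gap \<phi> (xh, uh) (x, u) m = ereal D" if "m \<ge> h" for m
  proof -
    have "(\<Sum>t=0..m. \<phi> t (xh t, uh t) - \<phi> t (x t, u t)) = (\<Sum>t\<le>h. \<phi> t (xh t, uh t) - \<phi> t (x t, u t))"
      using that tail by (intro sum.mono_neutral_right) auto
    then show ?thesis by (simp add: gap_def D_def sum_subtractf)
  qed
  have ev: "\<forall>\<^sub>F m in sequentially. gap \<phi> (xh, uh) (x, u) m = ereal D"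
    using gap eventually_sequentially by auto
  then have lim: "(gap \<phi> (xh, uh) (x, u)) \<longlonglongrightarrow> ereal D"
    by (rule tendsto_eventually)
  then have "limsup (gap \<phi> (xh, uh) (x, u)) = ereal D" "liminf (gap \<phi> (xh, uh) (x, u)) = ereal D"
    by (simp_all add: lim_imp_Limsup lim_imp_Liminf)
  with sol adm D have P1: "solves_P1 X U f \<sigma> \<phi> (xh, uh)"
    by (auto simp: solves_P_def solves_P2_def solves_P3_def)
  then have sh: "summable (\<lambda>t. \<phi> t (xh t, uh t))" by (simp add: solves_P1_def Dom_i_def)
  have "\<forall>\<^sub>F t in sequentially. \<phi> t (x t, u t) = \<phi> t (xh t, uh t)"
    using eventually_gt_at_top[of h] by eventually_elim (simp add: tail)
  \<comment> \<open>In the first problem the competitor must itself have a convergent series, which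
    the common tail guarantees.\<close>
  then have s: "summable (\<lambda>t. \<phi> t (x t, u t))" using sh by (simp add: summable_cong)
  have "(\<Sum>t. \<phi> t (xh t, uh t)) - (\<Sum>t. \<phi> t (x t, u t))
      = (\<Sum>t. \<phi> t (xh t, uh t) - \<phi> t (x t, u t))" by (rule suminf_diff[OF sh s])
  also have "\<dots> = (\<Sum>t\<le>h. \<phi> t (xh t, uh t) - \<phi> t (x t, u t))"
    using tail by (intro suminf_finite) auto
  also have "\<dots> = D" by (simp add: D_def sum_subtractf)
  finally have "J \<phi> (x, u) > J \<phi> (xh, uh)" using D by (simp add: J_def)
  moreover have "(x, u) \<in> Dom_i X U f \<sigma> \<phi>" using adm s by (simp add: Dom_i_def)
  ultimately show False using P1 by (force simp: solves_P1_def)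
qed

lemma solution_admissible: "solves_P l X U f \<sigma> \<phi> z \<Longrightarrow> z \<in> Adm_i X U f \<sigma>"
  by (auto simp: solves_P_def solves_P1_def solves_P2_def solves_P3_def Dom_i_def)

text \<open>The linearized inequalities are strict and concern finitely many times and constraints,
  so one small step satisfies all of them simultaneously.\<close>

lemma solution_no_improving_direction:
  fixes X :: "nat \<Rightarrow> (real^'n) set" and f :: "nat \<Rightarrow> (real^'n) \<times> (real^'d) \<Rightarrow> real^'n"
    and g e :: "nat \<Rightarrow> nat \<Rightarrow> real^'d \<Rightarrow> real"
  assumes X: "\<And>t. open (X t)"
    and U: "\<And>t. U t = (\<Inter>k\<in>{1..mi}. {u. g t k u \<ge> 0}) \<inter> (\<Inter>j\<in>{1..me}. {u. e t j u = 0})"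
    and sol: "solves_P l X U f \<sigma> \<phi> (xh, uh)"
    and \<phi>': "\<And>t. (\<phi> t has_derivative \<phi>' t) (at (xh t, uh t))"
    and f': "\<And>t \<alpha>. f t (xh t, uh t) $ \<alpha> = xh (Suc t) $ \<alpha> \<Longrightarrow>
        ((\<lambda>z. f t z $ \<alpha>) has_derivative (\<lambda>z. f' t z $ \<alpha>)) (at (xh t, uh t))"
    and f_lsc: "\<And>t \<alpha>. f t (xh t, uh t) $ \<alpha> > xh (Suc t) $ \<alpha> \<Longrightarrow>
        lsc_at_within (\<lambda>z. f t z $ \<alpha>) (xh t, uh t) (X t \<times> U t)"
    and g': "\<And>t k. k \<in> {1..mi} \<Longrightarrow> g t k (uh t) = 0 \<Longrightarrow>
        (g t k has_derivative g' t k) (at (uh t))"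
    and g_lsc: "\<And>t k. k \<in> {1..mi} \<Longrightarrow> g t k (uh t) > 0 \<Longrightarrow> lsc_at_within (g t k) (uh t) UNIV"
    and e_cont: "\<And>t j. j \<in> {1..me} \<Longrightarrow> \<exists>V. open V \<and> uh t \<in> V \<and> continuous_on V (e t j)"
    and e': "\<And>t j. j \<in> {1..me} \<Longrightarrow> (e t j has_derivative blinfun_apply (E t j)) (at (uh t))"
    and d: "\<And>t. \<forall>i\<in>{1..me}. \<forall>j\<in>{1..me}. E t i (d t j) = (if i = j then 1 else 0)"
    and y: "y 0 = 0" "\<And>t. t > h \<Longrightarrow> y t = 0"
    and v: "\<And>t j. j \<in> {1..me} \<Longrightarrow> E t j (v t) = 0"
    and \<phi>_pos: "(\<Sum>t\<le>h. \<phi>' t (y t, v t)) > 0"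
    and f_pos: "\<And>t \<alpha>. t \<le> h \<Longrightarrow> f t (xh t, uh t) $ \<alpha> = xh (Suc t) $ \<alpha> \<Longrightarrow>
        f' t (y t, v t) $ \<alpha> > y (Suc t) $ \<alpha>"
    and g_pos: "\<And>t k. t \<le> h \<Longrightarrow> k \<in> {1..mi} \<Longrightarrow> g t k (uh t) = 0 \<Longrightarrow> g' t k (v t) > 0"
  shows False
proof -
  have "(xh, uh) \<in> Adm_i X U f \<sigma>" using sol by (rule solution_admissible)
  then have adm: "xh t \<in> X t" "uh t \<in> U t" "xh 0 = \<sigma>" "xh (Suc t) \<le> f t (xh t, uh t)" for t
    by (auto simp: Adm_i_def)
  have g_nonneg: "g t k (uh t) \<ge> 0" if "k \<in> {1..mi}" for t k
    using adm(2)[of t] that unfolding U by blast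
  have e_zero: "e t j (uh t) = 0" if "j \<in> {1..me}" for t j
    using adm(2)[of t] that unfolding U by blast
  \<comment> \<open>One tolerance bounds both the step length and the correction, so that along a
    single sequence \<open>s n\<close> tends to 0 and \<open>w n t\<close> to
    \<open>v t\<close>.\<close>
  have "\<exists>s. 0 < s \<and> s < inverse (real (Suc n)) \<and> (\<forall>t\<in>{..h}. \<exists>w. norm (w - v t) \<le> inverse (real (Suc n)) \<and>
      (\<forall>j\<in>{1..me}. e t j (uh t + s *\<^sub>R w) = 0))" for n
  proof -
    define \<epsilon> where "\<epsilon> = inverse (real (Suc n))"
    have \<epsilon>: "\<epsilon> > 0" by (simp add: \<epsilon>_def)
    have "\<forall>\<^sub>F s in at_right 0. \<exists>w. norm (w - v t) \<le> \<epsilon> \<and> (\<forall>j\<in>{1..me}. e t j (uh t + s *\<^sub>R w) = 0)" for t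
      using e' d e_cont e_zero v \<epsilon> by (intro correct_to_zero_set[where E = "E t" and d = "d t"]) auto
    then have "\<forall>\<^sub>F s in at_right 0. \<forall>t\<in>{..h}. \<exists>w. norm (w - v t) \<le> \<epsilon> \<and>
        (\<forall>j\<in>{1..me}. e t j (uh t + s *\<^sub>R w) = 0)"
      by (simp add: eventually_ball_finite)
    moreover have "\<forall>\<^sub>F s in at_right 0. 0 < s \<and> s < \<epsilon>"
      using eventually_at_right_real[OF \<epsilon>] by simp
    ultimately have "\<forall>\<^sub>F s in at_right 0. 0 < s \<and> s < \<epsilon> \<and> (\<forall>t\<in>{..h}. \<exists>w. norm (w - v t) \<le> \<epsilon> \<and>
        (\<forall>j\<in>{1..me}. e t j (uh t + s *\<^sub>R w) = 0))"
      by eventually_elim blast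
    then show ?thesis unfolding \<epsilon>_def
      using eventually_happens trivial_limit_at_right_real by blast
  qed
  then obtain s where s: "\<And>n. 0 < s n" "\<And>n. s n < inverse (real (Suc n))"
    and ex_w: "\<And>n t. t \<in> {..h} \<Longrightarrow> \<exists>w. norm (w - v t) \<le> inverse (real (Suc n)) \<and>
      (\<forall>j\<in>{1..me}. e t j (uh t + s n *\<^sub>R w) = 0)"
    by metis
  obtain w where w: "\<And>n t. t \<le> h \<Longrightarrow> norm (w n t - v t) \<le> inverse (real (Suc n))"
    and ew: "\<And>n t j. t \<le> h \<Longrightarrow> j \<in> {1..me} \<Longrightarrow> e t j (uh t + s n *\<^sub>R w n t) = 0"
  proof -
    have "\<forall>n t. \<exists>w. t \<le> h \<longrightarrow> norm (w - v t) \<le> inverse (real (Suc n)) \<and>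
        (\<forall>j\<in>{1..me}. e t j (uh t + s n *\<^sub>R w) = 0)"
      using ex_w by (metis atMost_iff)
    then obtain w where "\<forall>n t. t \<le> h \<longrightarrow> norm (w n t - v t) \<le> inverse (real (Suc n)) \<and>
        (\<forall>j\<in>{1..me}. e t j (uh t + s n *\<^sub>R w n t) = 0)"
      by metis
    then show thesis by (intro that[of w]) blast+
  qed
  have s0: "s \<longlonglongrightarrow> 0"
    by (rule real_tendsto_sandwich[OF _ _ tendsto_const LIMSEQ_inverse_real_of_nat])
      (use s in \<open>auto intro!: always_eventually less_imp_le\<close>)
  have wv: "(\<lambda>n. w n t) \<longlonglongrightarrow> v t" if "t \<le> h" for t
    by (rule LIM_zero_cancel, rule Lim_null_comparison[OF _ LIMSEQ_inverse_real_of_nat])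
      (use w[OF that] in \<open>auto intro!: always_eventually\<close>)
  define x where "x = (\<lambda>n t. xh t + s n *\<^sub>R y t)"
  \<comment> \<open>\<open>v t\<close> may be nonzero after \<open>h\<close>, so the control is
    reset there explicitly; the state returns to the reference because
    \<open>y t = 0\<close>.\<close>
  define u where "u = (\<lambda>n t. if t \<le> h then uh t + s n *\<^sub>R w n t else uh t)"
  have x_lim: "(\<lambda>n. x n t) \<longlonglongrightarrow> xh t" for t
  proof -
    have "(\<lambda>n. xh t + s n *\<^sub>R y t) \<longlonglongrightarrow> xh t + 0 *\<^sub>R y t" by (intro tendsto_intros s0)
    then show ?thesis by (simp add: x_def)
  qed
  have u_lim: "(\<lambda>n. u n t) \<longlonglongrightarrow> uh t" for t
  proof (cases "t \<le> h")
    case True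
    have "(\<lambda>n. uh t + s n *\<^sub>R w n t) \<longlonglongrightarrow> uh t + 0 *\<^sub>R v t" by (intro tendsto_intros s0 wv True)
    then show ?thesis using True by (simp add: u_def)
  qed (simp add: u_def)
  have quot: "(\<lambda>n. (F (x n t, u n t) - F (xh t, uh t)) / s n) \<longlonglongrightarrow> F' (y t, v t)"
    if "(F has_derivative F') (at (xh t, uh t))" "t \<le> h" for F F' t
  proof -
    have "(\<lambda>n. (y t, w n t)) \<longlonglongrightarrow> (y t, v t)" by (intro tendsto_intros wv that)
    from difference_quotient_tendsto[OF that(1) s(1) s0 this] show ?thesis
      using that(2) by (simp add: x_def u_def)
  qed
  \<comment> \<open>Membership in \<open>U t\<close> comes before the dynamics, since lower
    semicontinuity of \<open>f\<close> is relative to \<open>X t \<times> U t\<close>.\<close>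
  have u_U: "\<forall>\<^sub>F n in sequentially. u n t \<in> U t" if t: "t \<le> h" for t
  proof -
    have "\<forall>\<^sub>F n in sequentially. g t k (u n t) \<ge> 0" if k: "k \<in> {1..mi}" for k
    proof (cases "g t k (uh t) = 0")
      case True
      have "(\<lambda>n. (g t k (uh t + s n *\<^sub>R w n t) - g t k (uh t)) / s n) \<longlonglongrightarrow> g' t k (v t)"
        by (rule difference_quotient_tendsto[OF g'[OF k True] s(1) s0 wv[OF t]])
      then have "\<forall>\<^sub>F n in sequentially. (g t k (uh t + s n *\<^sub>R w n t) - g t k (uh t)) / s n > 0"
        using g_pos[OF t k True] by (rule order_tendstoD)
      then show ?thesis
        by eventually_elim (use s(1) t True in \<open>auto simp: u_def zero_less_divide_iff dest: order.asym\<close>)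
    next
      case False
      then have "g t k (uh t) > 0" using g_nonneg[OF k, of t] by simp
      from lsc_at_within_sequentially[OF g_lsc[OF k this] this u_lim]
      have "\<forall>\<^sub>F n in sequentially. 0 < g t k (u n t)" by simp
      then show ?thesis by eventually_elim simp
    qed
    then have "\<forall>\<^sub>F n in sequentially. \<forall>k\<in>{1..mi}. g t k (u n t) \<ge> 0"
      by (simp add: eventually_ball_finite)
    then show ?thesis unfolding U
      by eventually_elim (use ew[OF t] t in \<open>auto simp: u_def\<close>)
  qed
  have x_X: "\<forall>\<^sub>F n in sequentially. x n t \<in> X t" for t
    using topological_tendstoD[OF x_lim X adm(1)] .
  have dyn: "\<forall>\<^sub>F n in sequentially. x n (Suc t) $ \<alpha> \<le> f t (x n t, u n t) $ \<alpha>" if t: "t \<le> h" for t \<alpha>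
  proof (cases "f t (xh t, uh t) $ \<alpha> = xh (Suc t) $ \<alpha>")
    case True
    have "\<forall>\<^sub>F n in sequentially. (f t (x n t, u n t) $ \<alpha> - f t (xh t, uh t) $ \<alpha>) / s n > y (Suc t) $ \<alpha>"
      using quot[OF f'[OF True] t] f_pos[OF t True] by (rule order_tendstoD)
    then show ?thesis
      by eventually_elim (use s(1) True in \<open>simp add: x_def pos_less_divide_eq mult.commute\<close>)
  next
    case False
    then have lt: "xh (Suc t) $ \<alpha> < f t (xh t, uh t) $ \<alpha>"
      using adm(4)[of t] by (simp add: less_eq_vec_def order.strict_iff_order)
    \<comment> \<open>The level \<open>c\<close> separates the two sides: semicontinuity keeps
      \<open>f\<close> above it, convergence keeps the next state below it.\<close>
    then obtain c where c: "xh (Suc t) $ \<alpha> < c" "c < f t (xh t, uh t) $ \<alpha>" using dense by blast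
    have "\<forall>\<^sub>F n in sequentially. c < f t (x n t, u n t) $ \<alpha>"
    proof (rule lsc_at_within_sequentially[OF f_lsc[OF lt] c(2)])
      show "(\<lambda>n. (x n t, u n t)) \<longlonglongrightarrow> (xh t, uh t)" by (intro tendsto_intros x_lim u_lim)
      show "\<forall>\<^sub>F n in sequentially. (x n t, u n t) \<in> X t \<times> U t"
        using x_X[of t] u_U[OF t] by eventually_elim simp
    qed
    moreover have "\<forall>\<^sub>F n in sequentially. x n (Suc t) $ \<alpha> < c"
      by (rule order_tendstoD(2)[OF tendsto_vec_nth[OF x_lim] c(1)])
    ultimately show ?thesis by eventually_elim simp
  qed
  have "(\<lambda>n. \<Sum>t\<le>h. (\<phi> t (x n t, u n t) - \<phi> t (xh t, uh t)) / s n) \<longlonglongrightarrow> (\<Sum>t\<le>h. \<phi>' t (y t, v t))"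
    by (intro tendsto_sum quot \<phi>') simp
  then have "\<forall>\<^sub>F n in sequentially. (\<Sum>t\<le>h. (\<phi> t (x n t, u n t) - \<phi> t (xh t, uh t)) / s n) > 0"
    using \<phi>_pos by (rule order_tendstoD)
  moreover have "\<forall>\<^sub>F n in sequentially. \<forall>t\<in>{..h}. u n t \<in> U t \<and> x n t \<in> X t \<and>
      (\<forall>\<alpha>\<in>UNIV. x n (Suc t) $ \<alpha> \<le> f t (x n t, u n t) $ \<alpha>)"
    using u_U x_X dyn by (simp add: eventually_ball_finite eventually_conj eventually_all_finite)
  ultimately have "\<forall>\<^sub>F n in sequentially.
      (\<Sum>t\<le>h. (\<phi> t (x n t, u n t) - \<phi> t (xh t, uh t)) / s n) > 0 \<and> (\<forall>t\<in>{..h}. u n t \<in> U t \<and>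
      x n t \<in> X t \<and> (\<forall>\<alpha>\<in>UNIV. x n (Suc t) $ \<alpha> \<le> f t (x n t, u n t) $ \<alpha>))"
    by (rule eventually_conj)
  then obtain n where n: "(\<Sum>t\<le>h. (\<phi> t (x n t, u n t) - \<phi> t (xh t, uh t)) / s n) > 0"
    "\<And>t. t \<le> h \<Longrightarrow> u n t \<in> U t" "\<And>t. t \<le> h \<Longrightarrow> x n t \<in> X t"
    "\<And>t \<alpha>. t \<le> h \<Longrightarrow> x n (Suc t) $ \<alpha> \<le> f t (x n t, u n t) $ \<alpha>"
    by (force dest: eventually_happens)
  \<comment> \<open>As \<open>y\<close> vanishes already at \<open>Suc h\<close>, the last perturbed
    stage lands on the reference state.\<close>
  have tail: "x n t = xh t \<and> u n t = uh t" if "t > h" for t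
    using that y(2)[OF that] by (simp add: x_def u_def)
  have "(x n, u n) \<in> Adm_i X U f \<sigma>"
    unfolding Adm_i_def
  proof (intro CollectI case_prodI conjI allI)
    show "x n 0 = \<sigma>" using y adm(3) by (simp add: x_def)
    fix t
    show "x n t \<in> X t" using n(3) tail adm(1) by (cases "t \<le> h") auto
    show "u n t \<in> U t" using n(2) tail adm(2) by (cases "t \<le> h") auto
    show "x n (Suc t) \<le> f t (x n t, u n t)"
      using n(4) tail[of t] tail[of "Suc t"] adm(4) by (cases "t \<le> h") (auto simp: less_eq_vec_def)
  qed
  from solves_P_finite_horizon[OF sol this tail]
  have "(\<Sum>t\<le>h. \<phi> t (x n t, u n t)) \<le> (\<Sum>t\<le>h. \<phi> t (xh t, uh t))" by simp
  moreover have "((\<Sum>t\<le>h. \<phi> t (x n t, u n t)) - (\<Sum>t\<le>h. \<phi> t (xh t, uh t))) / s n > 0"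
    using n(1) by (simp add: sum_divide_distrib[symmetric] sum_subtractf)
  ultimately show False using s(1)[of n] by (simp add: zero_less_divide_iff)
qed

subsection \<open>Infinite-horizon multiplier rule\<close>

theorem theorem4p7:
  fixes X :: "nat \<Rightarrow> (real^'n) set"
    and U :: "nat \<Rightarrow> (real^'d) set"
    and f :: "nat \<Rightarrow> (real^'n) \<times> (real^'d) \<Rightarrow> real^'n"
    and \<phi> :: "nat \<Rightarrow> (real^'n) \<times> (real^'d) \<Rightarrow> real"
    and \<sigma> :: "real^'n"
    and mi me :: nat
    and g e :: "nat \<Rightarrow> nat \<Rightarrow> real^'d \<Rightarrow> real"
    and l :: nat
    and xh :: "nat \<Rightarrow> real^'n" and uh :: "nat \<Rightarrow> real^'d"
  assumes X: "\<And>t. open (X t)" "\<And>t. X t \<noteq> {}"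
    and U_nonempty: "\<And>t. U t \<noteq> {}"
    and f_maps: "\<And>t x u. x \<in> X t \<Longrightarrow> u \<in> U t \<Longrightarrow> f t (x, u) \<in> X (Suc t)"
    and \<sigma>: "\<sigma> \<in> X 0"
    and U: "\<And>t. U t = (\<Inter>k\<in>{1..mi}. {u. g t k u \<ge> 0}) \<inter> (\<Inter>j\<in>{1..me}. {u. e t j u = 0})"
    and l: "l \<in> {1, 2, 3}"
    and sol: "solves_P l X U f \<sigma> \<phi> (xh, uh)"
    and i: "\<And>t. \<phi> t differentiable (at (xh t, uh t))"
    and ii: "\<And>t \<alpha>. f t (xh t, uh t) $ \<alpha> = xh (Suc t) $ \<alpha> \<Longrightarrow>
        (\<lambda>z. f t z $ \<alpha>) differentiable (at (xh t, uh t))"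
    and iii: "\<And>t \<alpha>. f t (xh t, uh t) $ \<alpha> > xh (Suc t) $ \<alpha> \<Longrightarrow>
        lsc_at_within (\<lambda>z. f t z $ \<alpha>) (xh t, uh t) (X t \<times> U t) \<and>
        gateaux_differentiable (\<lambda>z. f t z $ \<alpha>) (xh t, uh t)"
    and iv: "\<And>t k. k \<in> {1..mi} \<Longrightarrow> g t k (uh t) = 0 \<Longrightarrow> g t k differentiable (at (uh t))"
    and v: "\<And>t k. k \<in> {1..mi} \<Longrightarrow> g t k (uh t) > 0 \<Longrightarrow>
        lsc_at_within (g t k) (uh t) UNIV \<and> gateaux_differentiable (g t k) (uh t)"
    and vi: "\<And>t j. j \<in> {1..me} \<Longrightarrow>
        (\<exists>V. open V \<and> uh t \<in> V \<and> continuous_on V (e t j)) \<and> e t j differentiable (at (uh t))"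
    and vii: "\<And>t. span {D_F (e t j) (uh t) | j. j \<in> {1..me}} \<inter>
        convex hull {D_G (g t k) (uh t) | k. k \<in> {1..mi} \<and> g t k (uh t) = 0} = {}"
    and viii: "\<And>t c. (\<Sum>j=1..me. c j *\<^sub>R D_F (e t j) (uh t)) = 0 \<Longrightarrow> \<forall>j\<in>{1..me}. c j = (0::real)"
    and ix_or_x:
      "(\<forall>t\<ge>1. bij (blinfun_apply (D_G1 (f t) (xh t, uh t)))) \<or>
       (\<forall>t\<ge>1. (\<forall>\<alpha> \<beta>. matrix (blinfun_apply (D_G1 (f t) (xh t, uh t))) $ \<alpha> $ \<beta> \<ge> 0) \<and>
               (\<forall>\<alpha>. matrix (blinfun_apply (D_G1 (f t) (xh t, uh t))) $ \<alpha> $ \<alpha> > 0))"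
  shows "\<exists>(l0::real) (p :: nat \<Rightarrow> (real^'n) \<Rightarrow>\<^sub>L real)
            (lam :: nat \<Rightarrow> nat \<Rightarrow> real) (\<mu> :: nat \<Rightarrow> nat \<Rightarrow> real).
     (l0, p 1) \<noteq> (0, 0) \<and>
     (l0 \<ge> 0 \<and> (\<forall>t\<ge>1. \<forall>\<alpha>. dual_coord (p t) \<alpha> \<ge> 0) \<and> (\<forall>t. \<forall>k\<in>{1..mi}. \<mu> k t \<ge> 0)) \<and>
     (\<forall>t. (\<forall>\<alpha>. dual_coord (p (Suc t)) \<alpha> * (f t (xh t, uh t) $ \<alpha> - xh (Suc t) $ \<alpha>) = 0) \<and>
          (\<forall>k\<in>{1..mi}. \<mu> k t * g t k (uh t) = 0)) \<and>
     (\<forall>t\<ge>1. p t = (p (Suc t) o\<^sub>L D_G1 (f t) (xh t, uh t)) + l0 *\<^sub>R D_F1 (\<phi> t) (xh t, uh t)) \<and>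
     (\<forall>t. (p (Suc t) o\<^sub>L D_G2 (f t) (xh t, uh t)) + l0 *\<^sub>R D_F2 (\<phi> t) (xh t, uh t)
          + (\<Sum>j=1..me. lam j t *\<^sub>R D_F (e t j) (uh t))
          + (\<Sum>k=1..mi. \<mu> k t *\<^sub>R D_G (g t k) (uh t)) = 0)"
proof -
  have xh_le: "xh (Suc t) \<le> f t (xh t, uh t)" for t
    using solution_admissible[OF sol] by (simp add: Adm_i_def)
  have uh_U: "uh t \<in> U t" for t
    using solution_admissible[OF sol] by (simp add: Adm_i_def)
  define act where "act = (\<lambda>t. {\<alpha>. f t (xh t, uh t) $ \<alpha> = xh (Suc t) $ \<alpha>})"
  define K where "K = (\<lambda>t. {k \<in> {1..mi}. g t k (uh t) = 0})"
  define E where "E = (\<lambda>t j. D_F (e t j) (uh t))"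
  define b where "b = (\<lambda>t k. D_G (g t k) (uh t))"
  define N where "N = (\<lambda>t. {v. \<forall>j\<in>{1..me}. E t j v = 0})"
  define F where "F = (\<lambda>t z. \<chi> \<alpha>. dir_deriv (\<lambda>w. f t w $ \<alpha>) (xh t, uh t) z)"
  define \<phi>' where "\<phi>' = (\<lambda>t. frechet_derivative (\<phi> t) (at (xh t, uh t)))"
  \<comment> \<open>The vector representing the state derivative of the criterion: the transpose of
    a linear form, evaluated at 1.\<close>
  define r where "r = (\<lambda>t. adjoint (\<lambda>y. \<phi>' t (y, 0)) 1)"

  have gateaux: "gateaux_differentiable (\<lambda>z. f t z $ \<alpha>) (xh t, uh t)" for t \<alpha>
  proof (cases "f t (xh t, uh t) $ \<alpha> = xh (Suc t) $ \<alpha>")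
    case True
    then show ?thesis
      using ii has_derivative_imp_gateaux_differentiable unfolding differentiable_def by blast
  next
    case False
    then have "xh (Suc t) $ \<alpha> < f t (xh t, uh t) $ \<alpha>"
      using xh_le[of t] by (simp add: less_eq_vec_def order.strict_iff_order)
    then show ?thesis using iii by blast
  qed
  have F: "linear (F t)" "blinfun_apply (D_G1 (f t) (xh t, uh t)) y = F t (y, 0)"
    "blinfun_apply (D_G2 (f t) (xh t, uh t)) v = F t (0, v)" for t y v
    using joint_gateaux_derivative[OF gateaux] by (simp_all add: F_def)
  have F_split: "F t (y, v) = F t (y, 0) + F t (0, v)" for t y v
    using linear_add[OF F(1), of t "(y, 0)" "(0, v)"] by simp
  \<comment> \<open>At active coordinates the Gateaux differential is the Frechet one, which the
    perturbation argument requires.\<close>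
  have F_active: "((\<lambda>z. f t z $ \<alpha>) has_derivative (\<lambda>z. F t z $ \<alpha>)) (at (xh t, uh t))"
    if active: "f t (xh t, uh t) $ \<alpha> = xh (Suc t) $ \<alpha>" for t \<alpha>
  proof -
    obtain L where L: "((\<lambda>z. f t z $ \<alpha>) has_derivative L) (at (xh t, uh t))"
      using ii[OF active] unfolding differentiable_def by blast
    have "(\<lambda>z. F t z $ \<alpha>) = L"
      using dir_deriv_eqI[OF has_derivative_imp_diff_quot_tendsto[OF L]] by (simp add: F_def fun_eq_iff)
    then show ?thesis using L by simp
  qed
  have \<phi>': "(\<phi> t has_derivative \<phi>' t) (at (xh t, uh t))" for t
    using i unfolding \<phi>'_def by (simp add: frechet_derivative_works)
  have \<phi>'_lin: "linear (\<phi>' t)" for t using \<phi>' by (rule has_derivative_linear)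
  have \<phi>'_split: "\<phi>' t (y, v) = \<phi>' t (y, 0) + \<phi>' t (0, v)" for t y v
    using linear_add[OF \<phi>'_lin, of t "(y, 0)" "(0, v)"] by simp
  have r: "r t \<bullet> y = \<phi>' t (y, 0)" for t y
  proof -
    have "linear (\<lambda>y. \<phi>' t (y, 0))"
      by (rule linearI)
        (simp_all add: linear_add[OF \<phi>'_lin, symmetric] linear_scale[OF \<phi>'_lin, symmetric] del: real_scaleR_def)
    from adjoint_works[OF this, of y 1] show ?thesis by (simp add: r_def inner_commute)
  qed
  have E: "(e t j has_derivative blinfun_apply (E t j)) (at (uh t))" if "j \<in> {1..me}" for t j
    using vi[OF that, of t] D_F_apply unfolding E_def differentiable_def by metis
  have b: "(g t k has_derivative blinfun_apply (b t k)) (at (uh t))"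
    if active: "k \<in> {1..mi}" "g t k (uh t) = 0" for t k
  proof -
    obtain L where L: "(g t k has_derivative L) (at (uh t))"
      using iv[OF active] unfolding differentiable_def by blast
    have "blinfun_apply (b t k) = L" unfolding b_def
      by (intro D_G_apply_eqI has_derivative_linear[OF L]
          has_derivative_imp_diff_quot_tendsto[OF L])
    then show ?thesis using L by simp
  qed
  have "\<exists>d. \<forall>i\<in>{1..me}. \<forall>j\<in>{1..me}. E t i (d j) = (if i = j then 1 else 0)" for t
    using viii[of _ t] unfolding E_def by (intro dual_family) auto
  then obtain d where d: "\<And>t. \<forall>i\<in>{1..me}. \<forall>j\<in>{1..me}. E t i (d t j) = (if i = j then 1 else 0)"
    by metis
  have disj: "span {E t j | j. j \<in> {1..me}} \<inter> convex hull {b t k | k. k \<in> K t} = {}" for t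
    using vii[of t] unfolding E_def b_def K_def by simp
  have K: "finite (K t)" for t by (simp add: K_def)

  interpret linearized_problem act K N r "\<lambda>t v. \<phi>' t (0, v)" "\<lambda>t y. F t (y, 0)"
    "\<lambda>t v. F t (0, v)" "\<lambda>t k. blinfun_apply (b t k)"
  proof (rule linearized_problem.intro)
    show "finite (K t)" for t by (rule K)
    show "subspace (N t)" for t
      by (auto simp: N_def subspace_def blinfun.add_right blinfun.scaleR_right)
    show "linear (\<lambda>v. \<phi>' t (0, v))" for t
      by (rule linearI)
        (simp_all add: linear_add[OF \<phi>'_lin, symmetric] linear_scale[OF \<phi>'_lin, symmetric] del: real_scaleR_def)
    show "linear (\<lambda>y. F t (y, 0))" "linear (\<lambda>v. F t (0, v))" for t
      by (rule linearI;
          simp add: linear_add[OF F(1), symmetric] linear_scale[OF F(1), symmetric])+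
    show "linear (blinfun_apply (b t k))" for t k
      by (simp add: blinfun.bounded_linear_right bounded_linear.linear)
    show "\<exists>v\<in>N t. \<forall>k\<in>K t. b t k v > 0" for t
      using regular_direction_exists[OF _ K d disj] by (auto simp: N_def)
    show "\<not> (y 0 = 0 \<and> (\<forall>t>h. y t = 0) \<and> (\<forall>t. v t \<in> N t) \<and>
        (\<Sum>t\<le>h. r t \<bullet> y t + \<phi>' t (0, v t)) > 0 \<and>
        (\<forall>t\<le>h. \<forall>\<alpha>\<in>act t. (F t (y t, 0) + F t (0, v t)) $ \<alpha> > y (Suc t) $ \<alpha>) \<and>
        (\<forall>t\<le>h. \<forall>k\<in>K t. b t k (v t) > 0))" for y h v
    proof (intro notI, elim conjE)
      assume y: "y 0 = 0" "\<forall>t>h. y t = 0" and vN: "\<forall>t. v t \<in> N t"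
        and pos: "(\<Sum>t\<le>h. r t \<bullet> y t + \<phi>' t (0, v t)) > 0"
          "\<forall>t\<le>h. \<forall>\<alpha>\<in>act t. (F t (y t, 0) + F t (0, v t)) $ \<alpha> > y (Suc t) $ \<alpha>"
          "\<forall>t\<le>h. \<forall>k\<in>K t. b t k (v t) > 0"
      show False
      proof (rule solution_no_improving_direction[OF X(1) U sol \<phi>' F_active _ b _ _ E d])
        show "(\<Sum>t\<le>h. \<phi>' t (y t, v t)) > 0" using pos(1) by (simp add: r \<phi>'_split[symmetric])
        show "F t (y t, v t) $ \<alpha> > y (Suc t) $ \<alpha>"
          if "t \<le> h" "f t (xh t, uh t) $ \<alpha> = xh (Suc t) $ \<alpha>" for t \<alpha>
          using pos(2) that by (simp add: act_def F_split[symmetric])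
      qed (use iii v vi y pos vN in \<open>auto simp: N_def K_def\<close>)
    qed
    \<comment> \<open>Under (ix), \<open>q\<close> is itself a value of the surjective state
      derivative, hence orthogonal to itself. Under (x), pairing with a basis vector gives a zero
      sum of nonnegative terms, whose diagonal term forces \<open>q $ \<beta> = 0\<close>.\<close>
    show "q = 0" if q: "\<forall>\<alpha>. q $ \<alpha> \<ge> 0" "\<forall>z. q \<bullet> F (Suc t) (z, 0) = 0" for q t
      using ix_or_x
    proof
      assume "\<forall>t\<ge>1. bij (blinfun_apply (D_G1 (f t) (xh t, uh t)))"
      then have "surj (blinfun_apply (D_G1 (f (Suc t)) (xh (Suc t), uh (Suc t))))"
        by (simp add: bij_is_surj)
      then obtain z where "q = F (Suc t) (z, 0)" unfolding surj_def F(2) by blast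
      then show "q = 0" using q(2) by (metis inner_eq_zero_iff)
    next
      assume *: "\<forall>t\<ge>1.
        (\<forall>\<alpha> \<beta>. matrix (blinfun_apply (D_G1 (f t) (xh t, uh t))) $ \<alpha> $ \<beta> \<ge> 0) \<and>
        (\<forall>\<alpha>. matrix (blinfun_apply (D_G1 (f t) (xh t, uh t))) $ \<alpha> $ \<alpha> > 0)"
      define M where "M = (\<lambda>\<alpha> \<beta>. F (Suc t) (axis \<beta> 1, 0) $ \<alpha>)"
      have M: "M \<alpha> \<beta> \<ge> 0" "M \<alpha> \<alpha> > 0" for \<alpha> \<beta>
        using *[rule_format, of "Suc t"] by (simp_all add: M_def matrix_def F(2))
      have "q $ \<beta> = 0" for \<beta>
      proof -
        have "(\<Sum>\<alpha>\<in>UNIV. q $ \<alpha> * M \<alpha> \<beta>) = 0"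
          using q(2)[rule_format, of "axis \<beta> 1"] by (simp add: M_def inner_vec_def)
        then have "q $ \<beta> * M \<beta> \<beta> = 0"
          using sum_nonneg_eq_0_iff[of UNIV "\<lambda>\<alpha>. q $ \<alpha> * M \<alpha> \<beta>"] q(1) M(1) by simp
        then show ?thesis using M(2)[of \<beta>] by simp
      qed
      then show "q = 0" by (simp add: vec_eq_iff)
    qed
  qed

  obtain c q where cq: "\<And>h. (c, q) \<in> multipliers h" using infinite_horizon_multipliers by blast
  have c: "c \<ge> 0" "c + norm (q 0) = 1" and q: "\<And>t \<alpha>. q t $ \<alpha> \<ge> 0"
    and inact: "\<And>t \<alpha>. \<alpha> \<notin> act t \<Longrightarrow> q t $ \<alpha> = 0"
    using cq[of 0] by (auto simp: multipliers_def)
  have ae: "q t \<bullet> z = q (Suc t) \<bullet> F (Suc t) (z, 0) + c * (r (Suc t) \<bullet> z)" for t z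
    using cq[of "Suc t"] lessI[of t] unfolding multipliers_def by blast
  have wm: "q t \<bullet> F t (0, v) + c * \<phi>' t (0, v) \<le> 0" if "v \<in> N t" "\<forall>k\<in>K t. b t k v > 0" for t v
    using cq[of t] that unfolding multipliers_def by blast
  \<comment> \<open>Indices are shifted: \<open>q t\<close> represents \<open>p (Suc t)\<close>.
    Truncated subtraction makes \<open>p 0\<close> equal to \<open>p 1\<close>; the conclusions
    concern \<open>p t\<close> for \<open>t >= 1\<close>.\<close>
  define p where "p = (\<lambda>t. blinfun_inner_right (q (t - 1)))"
  have p: "blinfun_apply (p (Suc t)) z = q t \<bullet> z" for t z by (simp add: p_def)
  \<comment> \<open>The part of (WM) that the control multipliers have to cancel; \<open>wm\<close>
    is the hypothesis of Farkas' lemma for it.\<close>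
  define \<psi> where "\<psi> = (\<lambda>t. (p (Suc t) o\<^sub>L D_G2 (f t) (xh t, uh t)) + c *\<^sub>R D_F2 (\<phi> t) (xh t, uh t))"
  have \<psi>: "blinfun_apply (\<psi> t) v = q t \<bullet> F t (0, v) + c * \<phi>' t (0, v)" for t v
    by (simp add: \<psi>_def blinfun.add_left blinfun.scaleR_left p F(3)
        partial_frechet_derivatives(2)[OF \<phi>'])
  have "\<forall>t. \<exists>lam \<mu>. (\<forall>k\<in>K t. \<mu> k \<ge> (0::real)) \<and>
      \<psi> t + (\<Sum>j\<in>{1..me}. lam j *\<^sub>R E t j) + (\<Sum>k\<in>K t. \<mu> k *\<^sub>R b t k) = 0"
    using wm \<psi> by (intro allI farkas_regular[OF _ K d disj]) (auto simp: N_def)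
  from choice[OF this] obtain lam where
    "\<forall>t. \<exists>\<mu>. (\<forall>k\<in>K t. \<mu> k \<ge> (0::real)) \<and>
      \<psi> t + (\<Sum>j\<in>{1..me}. lam t j *\<^sub>R E t j) + (\<Sum>k\<in>K t. \<mu> k *\<^sub>R b t k) = 0" ..
  from choice[OF this] obtain \<mu> where
    "\<forall>t. (\<forall>k\<in>K t. \<mu> t k \<ge> (0::real)) \<and>
      \<psi> t + (\<Sum>j\<in>{1..me}. lam t j *\<^sub>R E t j) + (\<Sum>k\<in>K t. \<mu> t k *\<^sub>R b t k) = 0" ..
  then have \<mu>: "\<And>t k. k \<in> K t \<Longrightarrow> \<mu> t k \<ge> 0"
    and st: "\<And>t. \<psi> t + (\<Sum>j\<in>{1..me}. lam t j *\<^sub>R E t j) + (\<Sum>k\<in>K t. \<mu> t k *\<^sub>R b t k) = 0"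
    by blast+
  \<comment> \<open>Zero weight at inactive constraints gives complementary slackness and reduces
    the sum in (WM) to \<open>K t\<close>.\<close>
  define \<nu> where "\<nu> = (\<lambda>k t. if k \<in> K t then \<mu> t k else 0)"
  show ?thesis
  proof (rule exI[of _ c], rule exI[of _ p], rule exI[of _ "\<lambda>j t. lam t j"], rule exI[of _ \<nu>],
      intro conjI allI impI ballI)
    show "(c, p 1) \<noteq> (0, 0)"
    proof
      assume 0: "(c, p 1) = (0, 0)"
      then have "q 0 \<bullet> q 0 = 0" using p[of 0 "q 0"] by simp
      then show False using 0 c by simp
    qed
    show "c \<ge> 0" by (rule c)
    show "dual_coord (p t) \<alpha> \<ge> 0" for t \<alpha>
      using q by (simp add: dual_coord_def p_def inner_axis)
    show "\<nu> k t \<ge> 0" for k t using \<mu> by (simp add: \<nu>_def)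
    show "dual_coord (p (Suc t)) \<alpha> * (f t (xh t, uh t) $ \<alpha> - xh (Suc t) $ \<alpha>) = 0" for t \<alpha>
      using inact[of \<alpha> t] by (auto simp: dual_coord_def p inner_axis act_def)
    show "\<nu> k t * g t k (uh t) = 0" for k t by (simp add: \<nu>_def K_def)
    show "p t = (p (Suc t) o\<^sub>L D_G1 (f t) (xh t, uh t)) + c *\<^sub>R D_F1 (\<phi> t) (xh t, uh t)"
      if t: "t \<ge> 1" for t
    proof (rule blinfun_eqI)
      fix z
      obtain s where s: "t = Suc s" using t by (cases t) auto
      show "p t z = ((p (Suc t) o\<^sub>L D_G1 (f t) (xh t, uh t)) + c *\<^sub>R D_F1 (\<phi> t) (xh t, uh t)) z"
        using ae[of s z]
        by (simp add: s blinfun.add_left blinfun.scaleR_left p F(2) r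
            partial_frechet_derivatives(1)[OF \<phi>'])
    qed
    show "(p (Suc t) o\<^sub>L D_G2 (f t) (xh t, uh t)) + c *\<^sub>R D_F2 (\<phi> t) (xh t, uh t)
        + (\<Sum>j=1..me. lam t j *\<^sub>R D_F (e t j) (uh t))
        + (\<Sum>k=1..mi. \<nu> k t *\<^sub>R D_G (g t k) (uh t)) = 0" for t
    proof -
      have "(\<Sum>k=1..mi. \<nu> k t *\<^sub>R D_G (g t k) (uh t)) = (\<Sum>k\<in>K t. \<mu> t k *\<^sub>R b t k)"
        by (rule sum.mono_neutral_cong_right) (auto simp: K_def \<nu>_def b_def)
      then show ?thesis using st[of t] unfolding \<psi>_def E_def by simp
    qed
  qed
qed

end
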